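(* For every integer $n\ge 6$, $\chi_l(K(n,3))=n-4$.
   Context: The Kneser graph $K(n,3)$ has as vertices all $3$-subsets of $[n]$, two being adjacent iff disjoint. A proper coloring of a graph assigns colors to vertices so that adjacent vertices get distinct colors. The locality of a proper coloring is the maximum, over vertices $v$, of the number of distinct colors appearing on the closed neighborhood $\{v\}\cup N(v)$. The local chromatic number $\chi_l(G)$ is the minimum locality of a proper coloring of $G$. *)

theory Defs
  imports Main
begin

(* A graph is given by a finite vertex set V and a symmetric adjacency relation E. *)

definition proper_coloring :: "'a set \<Rightarrow> ('a \<Rightarrow> 'a \<Rightarrow> bool) \<Rightarrow> ('a \<Rightarrow> nat) \<Rightarrow> bool" where
  "proper_coloring V E c \<longleftrightarrow> (\<forall>u\<in>V. \<forall>v\<in>V. E u v \<longrightarrow> c u \<noteq> c v)"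

definition closed_nbhd :: "'a set \<Rightarrow> ('a \<Rightarrow> 'a \<Rightarrow> bool) \<Rightarrow> 'a \<Rightarrow> 'a set" where
  "closed_nbhd V E v = insert v {u\<in>V. E v u}"

definition locality :: "'a set \<Rightarrow> ('a \<Rightarrow> 'a \<Rightarrow> bool) \<Rightarrow> ('a \<Rightarrow> nat) \<Rightarrow> nat" where
  "locality V E c = Max ((\<lambda>v. card (c ` closed_nbhd V E v)) ` V)"

definition local_chromatic_number :: "'a set \<Rightarrow> ('a \<Rightarrow> 'a \<Rightarrow> bool) \<Rightarrow> nat" where
  "local_chromatic_number V E =
     (LEAST k. \<exists>c. proper_coloring V E c \<and> locality V E c = k)"

definition kneser_vertices :: "nat \<Rightarrow> nat \<Rightarrow> nat set set" where
  "kneser_vertices n k = {A. A \<subseteq> {1..n} \<and> card A = k}"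

definition kneser_adj :: "nat set \<Rightarrow> nat set \<Rightarrow> bool" where
  "kneser_adj A B \<longleftrightarrow> A \<inter> B = {}"

end

theory Submission
  imports Defs "HOL-Library.Ramsey"
begin

text \<open>
  Call a colour seen from a triple \<open>v\<close> if some triple disjoint from \<open>v\<close> has it. By induction on the
  size \<open>n\<close> of the ground set, every proper colouring has a triple that sees at least \<open>n - 5\<close> colours.
  Suppose that every triple sees at most \<open>n - 6\<close>. For a point \<open>x\<close>, the induction hypothesis on the
  remaining points gives a triple \<open>v\<close> avoiding \<open>x\<close> that sees \<open>n - 6\<close> colours on triples avoiding
  \<open>x\<close>, hence no others: every colour class all of whose members contain \<open>x\<close> is covered by \<open>v\<close>, that
  is, \<open>v\<close> meets all its members.

  For a colour class \<open>F\<close> (an intersecting family) let \<open>N(F)\<close> be the number of triples meeting all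
  members of \<open>F\<close>. Counting pairs of a triple and a colour seen from it yields
  \<open>\<Sum>\<^sub>F (C(n,3) - N(F)) \<le> (n - 6) C(n,3) = (n - 6) \<Sum>\<^sub>F |F|\<close>. For \<open>n \<ge> 8\<close> one shows
  \<open>N(F) + (n - 6) |F| < C(n,3)\<close> for every intersecting family that is not a star, in the spirit of
  the Hilton-Milner theorem, and for every star covered by a triple avoiding its centre. The
  latter fails, by one, only for the largest covered stars when \<open>n = 10\<close> or \<open>n = 11\<close>, and then
  integrality gives the contradiction.
\<close>

section \<open>Transversals of set families\<close>

text \<open>For a colour class \<open>F\<close> of triples, \<open>card (transversals S 3 F)\<close>
  is the number \<open>N(F)\<close> of the overview. Members of \<open>F\<close> may have another
  size than \<open>k\<close>: links of classes are graphs, and their transversals are counted for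
  both \<open>k = 2\<close> and \<open>k = 3\<close>.\<close>

definition transversals :: "'a set \<Rightarrow> nat \<Rightarrow> 'a set set \<Rightarrow> 'a set set" where
  "transversals S k F = {v \<in> nsets S k. \<forall>u\<in>F. u \<inter> v \<noteq> {}}"

lemma transversals_subset: "transversals S k F \<subseteq> nsets S k"
  by (auto simp: transversals_def)

lemma finite_transversals [simp]: "finite S \<Longrightarrow> finite (transversals S k F)"
  by (meson transversals_subset finite_imp_finite_nsets finite_subset)

lemma transversals_meets:
  assumes "v \<in> transversals S k F" "e \<in> F"
  obtains x where "x \<in> e" "x \<in> v"
  using assms by (auto simp: transversals_def)

section \<open>Binomial coefficients and counts by excluded sets\<close>

lemma choose_two_add_2: "q + 2 choose 2 = (q choose 2) + 2 * q + 1"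
  by (simp add: numeral_2_eq_2)

lemma two_choose_two: "2 * int (n choose 2) = int n * (int n - 1)"
  by (induction n) (auto simp: numeral_2_eq_2 algebra_simps)

lemma six_choose_three: "6 * int (n choose 3) = int n * (int n - 1) * (int n - 2)"
proof (induction n)
  case (Suc n)
  have "Suc n choose 3 = (n choose 3) + (n choose 2)"
    by (simp add: numeral_3_eq_3 numeral_2_eq_2)
  with Suc two_choose_two[of n] show ?case
    by (simp add: algebra_simps)
qed auto

lemma obtain_two_elements:
  assumes "card A \<ge> 2"
  obtains x y where "x \<in> A" "y \<in> A" "x \<noteq> y"
proof -
  obtain B where "B \<subseteq> A" "card B = 2" using obtain_subset_with_card_n[OF assms] by metis
  then show ?thesis using that by (auto simp: card_2_iff)
qed

text \<open>The \<open>k\<close>-subsets of \<open>S - e\<close> miss \<open>e\<close>, so none of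
  them is a transversal.\<close>

lemma card_transversals_miss:
  assumes "finite S" "e \<in> F" "e \<subseteq> S"
  shows "card (transversals S k F) + (card S - card e choose k) \<le> card S choose k"
proof -
  have "transversals S k F \<inter> nsets (S - e) k = {}"
    using assms by (auto simp: transversals_def nsets_def)
  moreover have "transversals S k F \<union> nsets (S - e) k \<subseteq> nsets S k"
    by (auto simp: transversals_def nsets_def)
  ultimately show ?thesis
    using assms card_mono[of "nsets S k" "transversals S k F \<union> nsets (S - e) k"]
    by (simp add: card_Un_disjoint finite_imp_finite_nsets card_Diff_subset finite_subset)
qed

text \<open>Inclusion-exclusion on the sets missing \<open>e\<close> and those missing
  \<open>e'\<close>; the sets missing \<open>e \<union> e'\<close> are the ones counted
  twice.\<close>

lemma card_transversals_miss2:
  assumes "finite S" "e \<in> F" "e' \<in> F" "e \<in> nsets S m" "e' \<in> nsets S m"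
  shows "card (transversals S k F) + 2 * (card S - m choose k)
       \<le> (card S choose k) + (card S - card (e \<union> e') choose k)"
proof -
  let ?T = "transversals S k F" and ?A = "nsets (S - e) k" and ?B = "nsets (S - e') k"
  have fin: "finite ?T" "finite ?A" "finite ?B" "finite e" "finite e'"
    using assms by (auto simp: finite_imp_finite_nsets nsets_def)
  have sub: "e \<subseteq> S" "e' \<subseteq> S" "card e = m" "card e' = m" using assms by (auto simp: nsets_def)
  have "?T \<inter> (?A \<union> ?B) = {}"
    using assms by (auto simp: transversals_def nsets_def)
  then have "card (?T \<union> (?A \<union> ?B)) = card ?T + card (?A \<union> ?B)"
    using fin by (simp add: card_Un_disjoint)
  moreover have "?T \<union> (?A \<union> ?B) \<subseteq> nsets S k"
    by (auto simp: transversals_def nsets_def)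
  then have "card (?T \<union> (?A \<union> ?B)) \<le> card S choose k"
    using assms(1) card_mono[of "nsets S k" "?T \<union> (?A \<union> ?B)"]
    by (simp add: finite_imp_finite_nsets)
  moreover have "card ?A + card ?B = card (?A \<union> ?B) + card (?A \<inter> ?B)"
    using fin by (rule_tac card_Un_Int) auto
  moreover have "?A \<inter> ?B = nsets (S - (e \<union> e')) k" by (auto simp: nsets_def)
  moreover have "card ?A = card S - m choose k" "card ?B = card S - m choose k"
    "card (nsets (S - (e \<union> e')) k) = card S - card (e \<union> e') choose k"
    using assms(1) fin sub by (simp_all add: card_Diff_subset)
  ultimately show ?thesis by simp
qed

lemma card_supersets_le:
  assumes "finite S" "A \<subseteq> S"
  shows "card {v \<in> nsets S (card A + k). A \<subseteq> v} \<le> (card S - card A choose k)"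
proof -
  have fA: "finite A" using assms finite_subset by blast
  have "v - A \<in> nsets (S - A) k \<and> A \<union> (v - A) = v" if "v \<in> nsets S (card A + k)" "A \<subseteq> v" for v
    using that fA by (auto simp: nsets_def card_Diff_subset)
  then have "{v \<in> nsets S (card A + k). A \<subseteq> v} \<subseteq> (\<union>) A ` nsets (S - A) k"
    by (smt (verit) image_iff mem_Collect_eq subsetI)
  then have "card {v \<in> nsets S (card A + k). A \<subseteq> v} \<le> card (nsets (S - A) k)"
    using assms(1) by (intro surj_card_le) (auto simp: finite_imp_finite_nsets)
  then show ?thesis
    using assms fA by (simp add: card_Diff_subset)
qed

section \<open>Graphs: transversals of families of pairs\<close>

text \<open>A transversal avoiding \<open>a\<close> meets each edge through \<open>a\<close> in its
  other endpoint. Contrapositively, a vertex of degree above \<open>k\<close> lies in every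
  transversal of size \<open>k\<close>.\<close>

lemma degree_le_transversal:
  assumes "G \<subseteq> nsets Q 2" "v \<in> transversals Q k G" "a \<notin> v"
  shows "card {e \<in> G. a \<in> e} \<le> k"
proof -
  have v: "finite v" "card v = k" using assms(2) by (auto simp: transversals_def nsets_def)
  have "e \<in> (\<lambda>y. {a, y}) ` v" if e: "e \<in> G" "a \<in> e" for e
  proof -
    obtain y where "y \<in> e" "y \<in> v" using e(1) assms(2) by (auto simp: transversals_def)
    moreover have "card e = 2" using e assms(1) by (auto simp: nsets_def)
    ultimately have "e = {a, y}" using e(2) assms(3) by (auto simp: card_2_iff)
    with \<open>y \<in> v\<close> show ?thesis by blast
  qed
  then have "{e \<in> G. a \<in> e} \<subseteq> (\<lambda>y. {a, y}) ` v" by blast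
  then show ?thesis using v surj_card_le by metis
qed

lemma card_edges_meeting:
  assumes "finite Q" "G \<subseteq> nsets Q 2" "B \<subseteq> Q" "\<And>e. e \<in> G \<Longrightarrow> e \<inter> B \<noteq> {}"
  shows "card G + (card Q - card B choose 2) \<le> card Q choose 2"
proof -
  have "G \<subseteq> transversals Q 2 {B}" using assms by (auto simp: transversals_def)
  then have "card G \<le> card (transversals Q 2 {B})" using assms by (simp add: card_mono)
  with card_transversals_miss[of Q B "{B}" 2] assms show ?thesis by force
qed

text \<open>If no two edges are disjoint, take edges \<open>{a, b}\<close> and
  \<open>{a, c}\<close>. An edge avoiding \<open>a\<close> must be \<open>{b, c}\<close>, and once
  it is present every edge through \<open>a\<close> has to meet it.\<close>

lemma three_edges_cases:
  assumes "G \<subseteq> nsets Q 2" "card G \<ge> 3"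
  obtains (disjoint) e e' where "e \<in> G" "e' \<in> G" "e \<inter> e' = {}"
    | (star) p where "\<And>e. e \<in> G \<Longrightarrow> p \<in> e"
    | (triangle) a b c where "a \<noteq> b" "a \<noteq> c" "b \<noteq> c" "G = {{a, b}, {a, c}, {b, c}}"
proof (cases "\<exists>e\<in>G. \<exists>e'\<in>G. e \<inter> e' = {}")
  case True then show ?thesis using disjoint by blast
next
  case False
  have two: "\<And>e. e \<in> G \<Longrightarrow> \<exists>x y. e = {x, y} \<and> x \<noteq> y" using assms by (auto simp: nsets_def card_2_iff)
  obtain e e' where e: "e \<in> G" "e' \<in> G" "e \<noteq> e'"
    using obtain_two_elements[of G] assms(2) by auto
  obtain a b c where abc: "e = {a, b}" "e' = {a, c}" "a \<noteq> b" "a \<noteq> c" "b \<noteq> c"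
  proof -
    obtain x y where xy: "e = {x, y}" "x \<noteq> y" using two e by blast
    obtain z w where zw: "e' = {z, w}" "z \<noteq> w" using two e by blast
    have "e \<inter> e' \<noteq> {}" using False e by blast
    then show ?thesis using that[of x y z] that[of x y w] that[of y x z] that[of y x w] xy zw e(3) by auto
  qed
  show ?thesis
  proof (cases "\<forall>f\<in>G. a \<in> f")
    case True then show ?thesis using star by blast
  next
    case nota: False
    have bc: "f = {b, c}" if "f \<in> G" "a \<notin> f" for f
    proof -
      have "f \<inter> e \<noteq> {}" "f \<inter> e' \<noteq> {}" using False e that by blast+
      then have "b \<in> f" "c \<in> f" using abc that by auto
      then show ?thesis using two[OF that(1)] abc by auto
    qed
    then have bcG: "{b, c} \<in> G" using nota by blast
    have "f = {a, b} \<or> f = {a, c}" if "f \<in> G" "a \<in> f" for f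
    proof -
      have "f \<inter> {b, c} \<noteq> {}" using False bcG that by blast
      then show ?thesis using two[OF that(1)] abc that by auto
    qed
    then have "G = {{a, b}, {a, c}, {b, c}}" using bc bcG e abc by blast
    then show ?thesis using triangle abc by blast
  qed
qed

lemma two_edges_cases:
  assumes "G \<subseteq> nsets Q 2" "card G \<ge> 2"
  obtains (disjoint) e e' where "e \<in> G" "e' \<in> G" "e \<inter> e' = {}"
    | (adjacent) a b c where "a \<noteq> b" "a \<noteq> c" "b \<noteq> c" "{a, b} \<in> G" "{a, c} \<in> G"
proof -
  have two: "\<And>e. e \<in> G \<Longrightarrow> \<exists>x y. e = {x, y} \<and> x \<noteq> y" using assms by (auto simp: nsets_def card_2_iff)
  obtain e e' where e: "e \<in> G" "e' \<in> G" "e \<noteq> e'"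
    using obtain_two_elements[of G] assms(2) by auto
  obtain x y where xy: "e = {x, y}" "x \<noteq> y" using two e by blast
  obtain z w where zw: "e' = {z, w}" "z \<noteq> w" using two e by blast
  show ?thesis
  proof (cases "e \<inter> e' = {}")
    case True with e show ?thesis using disjoint by blast
  next
    case False
    then consider "x = z" | "x = w" | "y = z" | "y = w" using xy zw by auto
    then show ?thesis
    proof cases
      case 1 then show ?thesis using adjacent[of x y w] xy zw e by auto
    next
      case 2 then show ?thesis using adjacent[of x y z] xy zw e by (auto simp: insert_commute)
    next
      case 3 then show ?thesis using adjacent[of y x w] xy zw e by (auto simp: insert_commute)
    next
      case 4 then show ?thesis using adjacent[of y x z] xy zw e by (auto simp: insert_commute)
    qed
  qed
qed

lemma card_transversals_two_disjoint_edges: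
  assumes "finite Q" "G \<subseteq> nsets Q 2" "e \<in> G" "e' \<in> G" "e \<inter> e' = {}"
  shows "card (transversals Q 2 G) \<le> 4"
proof -
  obtain a b where ab: "e = {a, b}" using assms by (auto simp: nsets_def card_2_iff)
  obtain c d where cd: "e' = {c, d}" using assms by (auto simp: nsets_def card_2_iff)
  have "v \<in> {{a, c}, {a, d}, {b, c}, {b, d}}" if v: "v \<in> transversals Q 2 G" for v
  proof -
    obtain x where "x \<in> e" "x \<in> v" using transversals_meets[OF v assms(3)] .
    moreover obtain y where "y \<in> e'" "y \<in> v" using transversals_meets[OF v assms(4)] .
    moreover have "card v = 2" using v by (auto simp: transversals_def nsets_def)
    ultimately have "v = {x, y}" using assms(5) by (auto simp: card_2_iff)
    then show ?thesis using \<open>x \<in> e\<close> \<open>y \<in> e'\<close> ab cd by auto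
  qed
  then have "transversals Q 2 G \<subseteq> set [{a, c}, {a, d}, {b, c}, {b, d}]" by auto
  from card_mono[OF finite_set this] card_length[of "[{a, c}, {a, d}, {b, c}, {b, d}]"] show ?thesis
    by simp
qed

lemma card_pairs_through:
  assumes "finite Q" "p \<in> Q"
  shows "card {v \<in> nsets Q 2. p \<in> v} \<le> card Q - 1"
  using card_supersets_le[of Q "{p}" 1] assms by (simp add: numeral_2_eq_2)

text \<open>Let q be the size of \<open>Q\<close>. One edge leaves C(q,2) - C(q-2,2) = 2q - 3 pairs.
  With two adjacent edges, a transversal contains the common vertex or joins the other two
  endpoints. With three edges, a star forces its centre into every transversal and a triangle admits
  only its own edges, while two disjoint edges always leave at most 4 pairs.\<close>

lemma card_transversals_pairs:
  assumes "finite Q" "G \<subseteq> nsets Q 2" "G \<noteq> {}" "card Q \<ge> 6"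
  shows "card (transversals Q 2 G) \<le> 2 * card Q - 3"
    and "card G \<ge> 2 \<Longrightarrow> card (transversals Q 2 G) \<le> card Q"
    and "card G \<ge> 3 \<Longrightarrow> card (transversals Q 2 G) \<le> card Q - 1"
    and "card G \<ge> 3 \<Longrightarrow> card (transversals Q 2 G) \<le> 4 \<or> card G \<le> card Q - 1"
proof -
  obtain e where e: "e \<in> G" using assms by blast
  then have ce: "e \<subseteq> Q" "card e = 2" using assms by (auto simp: nsets_def)
  define r where "r = card Q - 2"
  then have r: "card Q = r + 2" using assms(4) by simp
  show "card (transversals Q 2 G) \<le> 2 * card Q - 3"
    using card_transversals_miss[OF assms(1) e ce(1), of 2] choose_two_add_2[of r] ce r by simp
  show "card (transversals Q 2 G) \<le> card Q" if "card G \<ge> 2"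
    using assms(2) that
  proof (cases rule: two_edges_cases)
    case (disjoint e e')
    from card_transversals_two_disjoint_edges[OF assms(1,2) this] show ?thesis using assms(4) by linarith
  next
    case (adjacent a b c)
    have "v \<in> insert {b, c} {v \<in> nsets Q 2. a \<in> v}" if v: "v \<in> transversals Q 2 G" for v
    proof (cases "a \<in> v")
      case False
      then have "b \<in> v" "c \<in> v" using adjacent v by (auto simp: transversals_def)
      moreover have "card v = 2" using v by (auto simp: transversals_def nsets_def)
      ultimately show ?thesis using adjacent by (auto simp: card_2_iff)
    qed (use v transversals_subset in blast)
    then have "card (transversals Q 2 G) \<le> card (insert {b, c} {v \<in> nsets Q 2. a \<in> v})"
      using assms(1) by (intro card_mono) (auto simp: finite_imp_finite_nsets)
    also have "\<dots> \<le> Suc (card {v \<in> nsets Q 2. a \<in> v})" by (rule card_insert_le_m1) auto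
    also have "\<dots> \<le> Suc (card Q - 1)"
      using card_pairs_through[OF assms(1), of a] adjacent assms(2) by auto
    finally show ?thesis using assms(4) by linarith
  qed
  show "card (transversals Q 2 G) \<le> card Q - 1" if "card G \<ge> 3"
    using assms(2) that
  proof (cases rule: three_edges_cases)
    case (disjoint e e')
    from card_transversals_two_disjoint_edges[OF assms(1,2) this] show ?thesis using assms(4) by linarith
  next
    case (star p)
    have "p \<in> v" if v: "v \<in> transversals Q 2 G" for v
    proof (rule ccontr)
      assume "p \<notin> v"
      from degree_le_transversal[OF assms(2) v this] have "card {e \<in> G. p \<in> e} \<le> 2" .
      moreover have "{e \<in> G. p \<in> e} = G" using star by auto
      ultimately show False using \<open>card G \<ge> 3\<close> by simp
    qed
    then have "card (transversals Q 2 G) \<le> card {v \<in> nsets Q 2. p \<in> v}"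
      using assms(1) transversals_subset by (intro card_mono) (fastforce simp: finite_imp_finite_nsets)+
    moreover have "p \<in> Q" using star e ce by auto
    ultimately show ?thesis using card_pairs_through[OF assms(1)] le_trans by blast
  next
    case (triangle a b c)
    have "v \<in> G" if v: "v \<in> transversals Q 2 G" for v
    proof -
      have "card v = 2" using v by (auto simp: transversals_def nsets_def)
      then show ?thesis using v triangle by (auto simp: transversals_def card_2_iff insert_commute)
    qed
    then have "card (transversals Q 2 G) \<le> card G" using triangle by (intro card_mono) auto
    also have "card G \<le> 3" using triangle by (auto simp: card_insert_if)
    finally show ?thesis using assms(4) by linarith
  qed
  show "card (transversals Q 2 G) \<le> 4 \<or> card G \<le> card Q - 1" if "card G \<ge> 3"
    using assms(2) that
  proof (cases rule: three_edges_cases)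
    case (disjoint e e')
    from card_transversals_two_disjoint_edges[OF assms(1,2) this] show ?thesis by blast
  next
    case (star p)
    then have "card G \<le> card {v \<in> nsets Q 2. p \<in> v}"
      using assms(1,2) by (intro card_mono) (auto simp: finite_imp_finite_nsets)
    moreover have "p \<in> Q" using star e ce by auto
    ultimately show ?thesis using card_pairs_through[OF assms(1)] le_trans by blast
  next
    case (triangle a b c)
    then show ?thesis using assms(4) by (auto simp: card_insert_if)
  qed
qed

section \<open>Graphs with a vertex cover of size three\<close>

text \<open>\<open>G\<close> is meant as the link of the centre of a star, and \<open>v\<close> as a
  triple covering the star. Vertices of degree at least 4 lie in every transversal triple. The
  alternatives arise from the number of such vertices in \<open>v\<close>: three (the first), two
  (the next two), one (the fourth and fifth) or none (the last two).\<close>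

lemma star_link_cases:
  assumes "finite Q" "G \<subseteq> nsets Q 2" "G \<noteq> {}" "card Q = r + 7" "v \<in> transversals Q 3 G"
  defines "t \<equiv> card (transversals Q 3 G)"
  shows "card G \<le> 3 * r + 15 \<and> t \<le> 1
    \<or> card G \<le> 2 * r + 11 \<and> t \<le> r + 5
    \<or> card G \<le> 2 * r + 14 \<and> t \<le> 2
    \<or> card G \<le> r + 6 \<and> t \<le> (r + 6 choose 2)
    \<or> card G \<le> r + 12 \<and> t \<le> 2 * r + 9
    \<or> card G \<le> 3 \<and> t + (r + 5 choose 3) \<le> (r + 7 choose 3)
    \<or> card G \<le> 9 \<and> t + 2 * (r + 5 choose 3) \<le> (r + 7 choose 3) + (r + 3 choose 3)"
proof -
  let ?T = "transversals Q 3 G"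
  have choose: "r + 7 choose 2 = (r + 4 choose 2) + 3 * r + 15"
      "r + 7 choose 2 = (r + 5 choose 2) + 2 * r + 11" "r + 6 choose 2 = (r + 4 choose 2) + 2 * r + 9"
    by (simp_all add: numeral_eq_Suc)
  define deg where "deg x = card {e \<in> G. x \<in> e}" for x
  have finG: "finite G" using assms finite_imp_finite_nsets finite_subset by blast
  have v: "v \<subseteq> Q" "card v = 3" "\<And>e. e \<in> G \<Longrightarrow> e \<inter> v \<noteq> {}"
    using assms by (auto simp: transversals_def nsets_def)
  \<comment> \<open>Ordering by degree makes the vertices of degree at least 4 an initial segment of
    \<open>a, b, c\<close>.\<close>
  obtain a b c where abc: "v = {a, b, c}" "a \<noteq> b" "a \<noteq> c" "b \<noteq> c" "deg a \<ge> deg b" "deg b \<ge> deg c"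
  proof -
    obtain x y z where "v = {x, y, z}" "x \<noteq> y" "x \<noteq> z" "y \<noteq> z" using v(2) by (metis card_3_iff)
    then show ?thesis
      using that[of x y z] that[of x z y] that[of y x z] that[of y z x] that[of z x y] that[of z y x]
      by (smt (verit, ccfv_threshold) insert_commute nle_le)
  qed
  have tri: "u \<in> ?T \<Longrightarrow> card u = 3 \<and> u \<subseteq> Q" for u by (auto simp: transversals_def nsets_def)
  have heavy: "x \<in> u" if "deg x \<ge> 4" "u \<in> ?T" for x u
    using degree_le_transversal[OF assms(2) that(2), of x] that(1) by (force simp: deg_def)
  have meet: "a \<in> e \<or> b \<in> e \<or> c \<in> e" if "e \<in> G" for e using v(3)[OF that] abc by auto
  have degle: "deg x \<le> r + 6" if "x \<in> Q" for x
  proof -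
    have "deg x \<le> card {v \<in> nsets Q 2. x \<in> v}" unfolding deg_def
      using assms(1,2) by (intro card_mono) (auto simp: finite_imp_finite_nsets)
    then show ?thesis using card_pairs_through[OF assms(1) that] assms(4) by simp
  qed
  have inQ: "a \<in> Q" "b \<in> Q" "c \<in> Q" using v abc by auto
  consider "deg c \<ge> 4" | "deg c < 4" "deg b \<ge> 4" | "deg b < 4" "deg a \<ge> 4" | "deg a < 4" by linarith
  then show ?thesis
  proof cases
    case 1
    have "u = v" if "u \<in> ?T" for u
    proof -
      have "v \<subseteq> u" using heavy[of _ u] 1 abc that by auto
      then show ?thesis using tri[OF that] v assms(1) by (metis card_subset_eq finite_subset)
    qed
    then have "t \<le> card {v}" unfolding t_def by (intro card_mono) auto
    moreover have "card G \<le> 3 * r + 15"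
    proof -
      have "card G + (card Q - card v choose 2) \<le> card Q choose 2"
        using card_edges_meeting[OF assms(1,2) v(1)] v(3) by blast
      moreover have "card Q - card v = r + 4" using assms(4) v(2) by simp
      ultimately show ?thesis using choose(1) assms(4) by simp
    qed
    ultimately show ?thesis by simp
  next
    case 2
    \<comment> \<open>At most C(r+7,2) - C(r+5,2) = 2r + 11 edges meet \<open>{a, b}\<close>; any
      others pass through \<open>c\<close>, so there are at most 3. A single such edge leaves only
      its two endpoints as third point of a transversal.\<close>
    let ?E = "{e \<in> G. a \<in> e \<or> b \<in> e}"
    have "card ?E + (card Q - card {a, b} choose 2) \<le> card Q choose 2"
      using assms inQ by (intro card_edges_meeting) auto
    then have E: "card ?E \<le> 2 * r + 11" using choose(2) assms(4) abc by (simp add: add.commute)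
    have ab: "{a, b} \<subseteq> u" if "u \<in> ?T" for u using heavy[of _ u] 2 abc that by auto
    show ?thesis
    proof (cases "?E = G")
      case True
      have "t \<le> card {u \<in> nsets Q (card {a, b} + 1). {a, b} \<subseteq> u}"
        unfolding t_def using ab abc assms(1) transversals_subset[of Q 3 G]
        by (intro card_mono) (auto simp: finite_imp_finite_nsets eval_nat_numeral)
      also have "\<dots> \<le> r + 5" using card_supersets_le[of Q "{a, b}" 1] assms(1,4) inQ abc by simp
      finally show ?thesis using True E by auto
    next
      case False
      then obtain e where e: "e \<in> G" "a \<notin> e" "b \<notin> e" by blast
      then have ce: "card e = 2" "finite e" using assms(2) by (auto simp: nsets_def)
      have "u \<in> (\<lambda>y. {a, b, y}) ` e" if u: "u \<in> ?T" for u
      proof -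
        obtain y where y: "y \<in> e" "y \<in> u" using transversals_meets[OF u e(1)] .
        have "{a, b, y} \<subseteq> u" using ab[OF u] y by auto
        moreover have "card {a, b, y} = 3" using y e abc by (auto simp: card_insert_if)
        ultimately have "{a, b, y} = u" using tri[OF u] assms(1) by (metis card_subset_eq finite_subset)
        then show ?thesis using y by auto
      qed
      then have "t \<le> 2" unfolding t_def using surj_card_le[of e ?T "\<lambda>y. {a, b, y}"] ce by auto
      moreover have "G \<subseteq> ?E \<union> {e \<in> G. c \<in> e}" using meet by auto
      then have "card G \<le> card ?E + deg c" unfolding deg_def
        using finG by (metis (no_types, lifting) card_Un_le card_mono finite_Un finite_subset le_trans mem_Collect_eq subsetI)
      ultimately show ?thesis using E 2 by linarith
    qed
  next
    case 3
    have "G \<subseteq> {e \<in> G. a \<in> e} \<union> ({e \<in> G. b \<in> e} \<union> {e \<in> G. c \<in> e})" using meet by auto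
    then have "card G \<le> card ({e \<in> G. a \<in> e} \<union> ({e \<in> G. b \<in> e} \<union> {e \<in> G. c \<in> e}))"
      using finG by (intro card_mono) auto
    also have "\<dots> \<le> deg a + (deg b + deg c)" unfolding deg_def
      by (meson card_Un_le add_left_mono le_trans)
    finally have G: "card G \<le> r + 12" using 3 abc degle[OF inQ(1)] by linarith
    show ?thesis
    proof (cases "\<forall>e\<in>G. a \<in> e")
      case True
      then have "{e \<in> G. a \<in> e} = G" by auto
      then have "card G \<le> r + 6" using degle[OF inQ(1)] by (simp add: deg_def)
      moreover have "t \<le> card {u \<in> nsets Q (card {a} + 2). {a} \<subseteq> u}"
        unfolding t_def using heavy 3 assms(1) transversals_subset[of Q 3 G]
        by (intro card_mono) (auto simp: finite_imp_finite_nsets eval_nat_numeral)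
      then have "t \<le> (r + 6 choose 2)" using card_supersets_le[of Q "{a}" 2] assms(1,4) inQ by (simp add: add.commute)
      ultimately show ?thesis by blast
    next
      case False
      then obtain e where e: "e \<in> G" "a \<notin> e" by blast
      then have ce: "card e = 2" "e \<subseteq> Q - {a}" using assms(2) by (auto simp: nsets_def)
      \<comment> \<open>The two points of \<open>u\<close> besides \<open>a\<close> form a pair in
        \<open>Q - {a}\<close> meeting \<open>e\<close>, for which there are C(r+6,2) - C(r+4,2) =
        2r + 9 choices.\<close>
      have "u \<in> insert a ` transversals (Q - {a}) 2 {e}" if u: "u \<in> ?T" for u
      proof -
        have "a \<in> u" using heavy u 3 by blast
        moreover have "u \<inter> e \<noteq> {}" using u e by (auto simp: transversals_def)
        moreover have "finite u" using tri[OF u] assms(1) finite_subset by blast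
        ultimately have "u - {a} \<in> transversals (Q - {a}) 2 {e}" "insert a (u - {a}) = u"
          using tri[OF u] e by (auto simp: transversals_def nsets_def)
        then show ?thesis by (metis image_eqI)
      qed
      then have "t \<le> card (transversals (Q - {a}) 2 {e})"
        unfolding t_def using surj_card_le[of "transversals (Q - {a}) 2 {e}" ?T "insert a"] assms(1) by auto
      moreover have "card (Q - {a}) = r + 6" using assms(4) inQ by simp
      ultimately have "t \<le> 2 * r + 9"
        using card_transversals_miss[of "Q - {a}" e "{e}" 2] choose(3) assms(1) ce by (simp add: add.commute)
      then show ?thesis using G by blast
    qed
  next
    case 4
    have "G \<subseteq> {e \<in> G. a \<in> e} \<union> ({e \<in> G. b \<in> e} \<union> {e \<in> G. c \<in> e})" using meet by auto
    then have "card G \<le> card ({e \<in> G. a \<in> e} \<union> ({e \<in> G. b \<in> e} \<union> {e \<in> G. c \<in> e}))"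
      using finG by (intro card_mono) auto
    also have "\<dots> \<le> deg a + (deg b + deg c)" unfolding deg_def
      by (meson card_Un_le add_left_mono le_trans)
    finally have G: "card G \<le> 9" using 4 abc by linarith
    show ?thesis
    proof (cases "card G \<le> 3")
      case True
      obtain e where e: "e \<in> G" using assms by blast
      then have "card e = 2" "e \<subseteq> Q" using assms(2) by (auto simp: nsets_def)
      then show ?thesis using True card_transversals_miss[OF assms(1) e, of 3] assms(4) by (simp add: t_def add.commute)
    next
      case False
      then have "3 \<le> card G" by simp
      with assms(2) show ?thesis
      proof (cases rule: three_edges_cases)
        case (disjoint e e')
        then have "e \<in> nsets Q 2" "e' \<in> nsets Q 2" using assms(2) by auto
        moreover from this have "card (e \<union> e') = 4" using disjoint by (simp add: nsets_def card_Un_disjoint)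
        ultimately show ?thesis
          using G card_transversals_miss2[OF assms(1) disjoint(1,2), of 2 3] assms(4) by (simp add: t_def add.commute)
      next
        \<comment> \<open>The centre of a star with at least 4 edges would lie in \<open>v\<close>,
          where all degrees are below 4.\<close>
        case (star p)
        obtain e where "e \<in> G" using assms by blast
        then have "deg p = card G" using star by (auto simp: deg_def intro: arg_cong[of _ _ card])
        then have "deg p \<ge> 4" using False by simp
        then have "p \<in> v" using heavy assms(5) by blast
        then have "deg p \<le> deg a" using abc by auto
        then show ?thesis using \<open>deg p \<ge> 4\<close> 4 by simp
      next
        case (triangle x y z)
        then have "card G \<le> 3" by (auto simp: card_insert_if)
        then show ?thesis using False by simp
      qed
    qed
  qed
qed

section \<open>Intersecting families of triples\<close>

text \<open>Any two points are missed by some \<open>w\<close> in \<open>F\<close>, so a transversal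
  through both has its third point in \<open>w\<close>: there are at most 3 of them. Every
  transversal contains one of 7 fixed pairs, which yields 21; the bound 16 refines this count for
  \<open>F\<close> itself.\<close>

lemma intersecting_no_two_cover_bound:
  assumes "finite S" "F \<subseteq> nsets S 3" "F \<noteq> {}"
    and inter: "\<And>u w. u \<in> F \<Longrightarrow> w \<in> F \<Longrightarrow> u \<inter> w \<noteq> {}"
    and nocover: "\<And>a b. a \<in> S \<Longrightarrow> b \<in> S \<Longrightarrow> a \<noteq> b \<Longrightarrow> \<exists>u\<in>F. a \<notin> u \<and> b \<notin> u"
  shows "card (transversals S 3 F) \<le> 21" and "card F \<le> 16"
proof -
  let ?T = "transversals S 3 F"
  have FT: "F \<subseteq> ?T" using assms(2) inter by (auto simp: transversals_def Int_commute)
  have finT: "finite ?T" using assms(1) by simp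
  have finF: "finite F" using FT finT finite_subset by blast
  have tri: "u \<in> ?T \<Longrightarrow> card u = 3 \<and> finite u \<and> u \<subseteq> S" for u by (auto simp: transversals_def nsets_def)
  have through: "{u \<in> ?T. a \<in> u \<and> b \<in> u} \<subseteq> (\<lambda>y. {a, b, y}) ` w"
    if w: "w \<in> F" "a \<notin> w" "b \<notin> w" "a \<noteq> b" for a b w
  proof
    fix u assume "u \<in> {u \<in> ?T. a \<in> u \<and> b \<in> u}"
    then have u: "u \<in> ?T" "a \<in> u" "b \<in> u" by auto
    obtain y where y: "y \<in> w" "y \<in> u" using transversals_meets[OF u(1) w(1)] .
    have "{a, b, y} \<subseteq> u" using u y by auto
    moreover have "card {a, b, y} = 3" using y w by (auto simp: card_insert_if)
    ultimately have "{a, b, y} = u" using tri[OF u(1)] by (metis card_subset_eq)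
    then show "u \<in> (\<lambda>y. {a, b, y}) ` w" using y by auto
  qed
  have le3: "card {u \<in> ?T. a \<in> u \<and> b \<in> u} \<le> 3" if ab: "a \<in> S" "b \<in> S" "a \<noteq> b" for a b
  proof -
    obtain w where w: "w \<in> F" "a \<notin> w" "b \<notin> w" using nocover[OF ab] by blast
    then have "card w = 3" "finite w" using FT tri by auto
    then show ?thesis using surj_card_le[OF _ through[OF w ab(3)]] by simp
  qed
  obtain A where A: "A \<in> F" using assms(3) by blast
  then have cA: "card A = 3" "A \<subseteq> S" using FT tri by auto
  then obtain o1 a b where oab: "A = {o1, a, b}" "o1 \<noteq> a" "o1 \<noteq> b" "a \<noteq> b" by (metis card_3_iff)
  obtain B where B: "B \<in> F" "a \<notin> B" "b \<notin> B" using nocover[of a b] oab cA by auto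
  then have cB: "card B = 3" "B \<subseteq> S" "finite B" using FT tri by auto
  have oB: "o1 \<in> B" using inter[OF A B(1)] oab B by auto
  then have cBo: "card (B - {o1}) = 2" "finite (B - {o1})" using cB by auto
  obtain C where C: "C \<in> F" "o1 \<notin> C" using nocover[of o1 a] oab cA by auto
  then have cC: "card C = 3" "C \<subseteq> S" "finite C" using FT tri by auto
  \<comment> \<open>\<open>B\<close> meets \<open>A\<close> only in \<open>o1\<close>, and
    \<open>C\<close> avoids \<open>o1\<close>. A transversal through \<open>o1\<close> also meets
    \<open>C\<close>; one avoiding \<open>o1\<close> contains \<open>a\<close> or \<open>b\<close>
    and a point of \<open>B - {o1}\<close>. This makes 3 + 4 pairs.\<close>
  define P where "P = (Pair o1 ` C) \<union> ({a, b} \<times> (B - {o1}))"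
  have finP: "finite P" using cC cBo by (simp add: P_def)
  have cP: "card P \<le> 7"
  proof -
    have "card P \<le> card (Pair o1 ` C) + card ({a, b} \<times> (B - {o1}))" unfolding P_def by (rule card_Un_le)
    also have "card (Pair o1 ` C) \<le> 3" using cC card_image_le by metis
    also have "card ({a, b} \<times> (B - {o1})) = 4" using oab cBo by (simp add: card_cartesian_product)
    finally show ?thesis by simp
  qed
  have PS: "fst p \<in> S \<and> snd p \<in> S \<and> fst p \<noteq> snd p" if "p \<in> P" for p
    using that C cC cA cB oab B by (auto simp: P_def)
  have cover: "?T \<subseteq> (\<Union>p\<in>P. {u \<in> ?T. fst p \<in> u \<and> snd p \<in> u})"
  proof
    fix u assume u: "u \<in> ?T"
    have "\<exists>p\<in>P. fst p \<in> u \<and> snd p \<in> u"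
    proof (cases "o1 \<in> u")
      case True
      obtain y where "y \<in> C" "y \<in> u" using transversals_meets[OF u C(1)] .
      then show ?thesis using True by (force simp: P_def)
    next
      case False
      obtain x where "x \<in> A" "x \<in> u" using transversals_meets[OF u A] .
      moreover obtain y where "y \<in> B" "y \<in> u" using transversals_meets[OF u B(1)] .
      ultimately have "(x, y) \<in> P" "x \<in> u" "y \<in> u" using False oab by (auto simp: P_def)
      then show ?thesis by force
    qed
    then show "u \<in> (\<Union>p\<in>P. {u \<in> ?T. fst p \<in> u \<and> snd p \<in> u})" using u by blast
  qed
  have "card ?T \<le> card (\<Union>p\<in>P. {u \<in> ?T. fst p \<in> u \<and> snd p \<in> u})"
    using cover finT finP by (intro card_mono) auto
  also have "\<dots> \<le> (\<Sum>p\<in>P. card {u \<in> ?T. fst p \<in> u \<and> snd p \<in> u})"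
    using finP by (rule card_UN_le)
  also have "\<dots> \<le> card P * 3"
    using sum_bounded_above[of P "\<lambda>p. card {u \<in> ?T. fst p \<in> u \<and> snd p \<in> u}" 3] le3 PS by simp
  finally show "card ?T \<le> 21" using cP by simp
  show "card F \<le> 16"
  proof (cases "\<exists>x\<in>S. \<exists>y\<in>S. x \<noteq> y \<and> card {u \<in> F. x \<in> u \<and> y \<in> u} \<ge> 3")
    \<comment> \<open>Here each of the 7 pairs lies in at most 2 members, so \<open>F\<close> has at
      most 14.\<close>
    case False
    have "F \<subseteq> (\<Union>p\<in>P. {u \<in> F. fst p \<in> u \<and> snd p \<in> u})" using cover FT by blast
    then have "card F \<le> card (\<Union>p\<in>P. {u \<in> F. fst p \<in> u \<and> snd p \<in> u})"
      using finF finP by (intro card_mono) auto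
    also have "\<dots> \<le> (\<Sum>p\<in>P. card {u \<in> F. fst p \<in> u \<and> snd p \<in> u})"
      using finP by (rule card_UN_le)
    also have "\<dots> \<le> (\<Sum>p\<in>P. 2)"
    proof (rule sum_mono)
      fix p assume "p \<in> P"
      then have "\<not> card {u \<in> F. fst p \<in> u \<and> snd p \<in> u} \<ge> 3" using False PS by blast
      then show "card {u \<in> F. fst p \<in> u \<and> snd p \<in> u} \<le> 2" by linarith
    qed
    finally show ?thesis using cP by simp
  next
    case True
    then obtain x y where xy: "x \<in> S" "y \<in> S" "x \<noteq> y" "card {u \<in> F. x \<in> u \<and> y \<in> u} \<ge> 3" by blast
    obtain w where w: "w \<in> F" "x \<notin> w" "y \<notin> w" using nocover xy by blast
    then have cw: "card w = 3" "finite w" "w \<subseteq> S" using FT tri by auto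
    let ?I = "(\<lambda>z. {x, y, z}) ` w"
    have Iw: "card ?I \<le> 3" using cw card_image_le by metis
    have sub: "{u \<in> F. x \<in> u \<and> y \<in> u} \<subseteq> ?I" using through[OF w xy(3)] FT by auto
    then have "{u \<in> F. x \<in> u \<and> y \<in> u} = ?I"
      using xy(4) Iw cw by (intro card_seteq) auto
    then have all: "{x, y, z} \<in> F" if "z \<in> w" for z using that by blast
    \<comment> \<open>A member with \<open>s\<close> but not \<open>s'\<close> meets
      \<open>w\<close> in some \<open>z\<close>. At most 3 members contain \<open>s\<close> and
      \<open>z\<close>, and one of these is \<open>{s, s', z}\<close>, so each of the three
      \<open>z\<close> contributes at most 2. The total is then 3 through both \<open>x\<close> and
      \<open>y\<close>, \<open>w\<close> itself, and 6 for each of the two points alone.\<close>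
    have few: "card {u \<in> F. s \<in> u \<and> s' \<notin> u} \<le> 6"
      if s: "s \<in> S" "s \<notin> w" "s' \<notin> w" "\<And>z. z \<in> w \<Longrightarrow> {s, s', z} \<in> F" "s' \<noteq> s" for s s'
    proof -
      have "{u \<in> F. s \<in> u \<and> s' \<notin> u} \<subseteq> (\<Union>z\<in>w. {u \<in> F. s \<in> u \<and> z \<in> u} - {{s, s', z}})"
        using inter[OF _ w(1)] by blast
      then have "card {u \<in> F. s \<in> u \<and> s' \<notin> u} \<le> card (\<Union>z\<in>w. {u \<in> F. s \<in> u \<and> z \<in> u} - {{s, s', z}})"
        using finF cw by (intro card_mono) auto
      also have "\<dots> \<le> (\<Sum>z\<in>w. card ({u \<in> F. s \<in> u \<and> z \<in> u} - {{s, s', z}}))"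
        using cw by (intro card_UN_le)
      also have "\<dots> \<le> (\<Sum>z\<in>w. 2)"
      proof (rule sum_mono)
        fix z assume z: "z \<in> w"
        have "card {u \<in> F. s \<in> u \<and> z \<in> u} \<le> card {u \<in> ?T. s \<in> u \<and> z \<in> u}"
          using FT finT by (intro card_mono) auto
        also have "\<dots> \<le> 3" using le3[of s z] z cw s by auto
        finally show "card ({u \<in> F. s \<in> u \<and> z \<in> u} - {{s, s', z}}) \<le> 2"
          using s(4)[OF z] finF by (simp add: card_Diff_singleton)
      qed
      finally show ?thesis using cw by simp
    qed
    have "u = w" if "u \<in> F" "x \<notin> u" "y \<notin> u" for u
    proof -
      have "w \<subseteq> u" using inter[OF that(1) all] that by auto
      then show ?thesis using cw tri[of u] FT that(1) by (metis card_subset_eq subsetD)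
    qed
    then have "F \<subseteq> ?I \<union> ({w} \<union> ({u \<in> F. x \<in> u \<and> y \<notin> u} \<union> {u \<in> F. y \<in> u \<and> x \<notin> u}))"
      using sub by auto
    then have "card F \<le> card (?I \<union> ({w} \<union> ({u \<in> F. x \<in> u \<and> y \<notin> u} \<union> {u \<in> F. y \<in> u \<and> x \<notin> u})))"
      using finF cw by (intro card_mono) auto
    also have "\<dots> \<le> card ?I + (card {w} + (card {u \<in> F. x \<in> u \<and> y \<notin> u} + card {u \<in> F. y \<in> u \<and> x \<notin> u}))"
      by (meson card_Un_le add_left_mono le_trans)
    also have "\<dots> \<le> 3 + (1 + (6 + 6))"
      using Iw few[of x y] few[of y x] xy w all by (intro add_mono) (auto simp: insert_commute)
    finally show ?thesis by simp
  qed
qed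

section \<open>Families covered by two points\<close>

text \<open>To be used with \<open>Q\<close> the ground set without two covering points,
  \<open>L\<close> the union of their links, and \<open>X\<close> the third points of members
  containing both. The extremes are \<open>X\<close> empty, with at most
  \<open>(r + 4) * (r + 4)\<close> transversals, and \<open>X = Q\<close>, with none left. In the
  former case a second edge lowers the bound by at least 3.\<close>

lemma card_transversals_supersets:
  assumes "finite Q" "card Q = r + 6" "L \<subseteq> nsets Q 2" "L \<noteq> {}" "X \<subseteq> Q"
  defines "c \<equiv> card {v \<in> transversals Q 3 L. X \<subseteq> v}"
  shows "c + (r + 2) * card X \<le> (r + 6) * (r + 2) + 4"
    and "card L \<ge> 2 \<Longrightarrow> c + (r + 2) * card X \<le> (r + 6) * (r + 2) + 1"
proof -
  have finX: "finite X" using assms finite_subset by blast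
  have ch: "r + 6 choose 3 = (r + 4 choose 3) + (r + 4) * (r + 4)"
    "r + 4 choose 3 = (r + 3 choose 3) + (r + 3 choose 2)"
    "r + 3 choose 2 \<ge> 3" "2 * (r + 5 choose 2) = (r + 5) * (r + 4)"
  proof -
    have "int (r + 6 choose 3) = int ((r + 4 choose 3) + (r + 4) * (r + 4))"
      using six_choose_three[of "r + 6"] six_choose_three[of "r + 4"]
      by (simp add: algebra_simps)
    then show "r + 6 choose 3 = (r + 4 choose 3) + (r + 4) * (r + 4)"
      using of_nat_eq_iff by blast
    show "r + 4 choose 3 = (r + 3 choose 3) + (r + 3 choose 2)" "r + 3 choose 2 \<ge> 3"
      by (simp_all add: numeral_eq_Suc)
    have "int (2 * (r + 5 choose 2)) = int ((r + 5) * (r + 4))"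
      using two_choose_two[of "r + 5"] by (simp add: algebra_simps)
    then show "2 * (r + 5 choose 2) = (r + 5) * (r + 4)"
      using of_nat_eq_iff by blast
  qed
  consider "card X = 0" | "card X = 1" | "2 \<le> card X" "card X \<le> 3" | "card X \<ge> 4" by linarith
  then have "c + (r + 2) * card X \<le> (r + 6) * (r + 2) + 4 \<and>
     (card L \<ge> 2 \<longrightarrow> c + (r + 2) * card X \<le> (r + 6) * (r + 2) + 1)"
  proof cases
    case 1
    have c: "c = card (transversals Q 3 L)" using 1 finX by (simp add: c_def)
    obtain e where e: "e \<in> L" using assms by blast
    then have "card e = 2" "e \<subseteq> Q" using assms(3) by (auto simp: nsets_def)
    with card_transversals_miss[OF assms(1) e, of 3] have "c + (r + 4 choose 3) \<le> r + 6 choose 3"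
      using c assms(2) by (simp add: add.commute)
    then have one: "c \<le> (r + 4) * (r + 4)" using ch by linarith
    moreover have "c + 3 \<le> (r + 4) * (r + 4)" if two: "card L \<ge> 2"
    proof -
      obtain e e' where ee: "e \<in> L" "e' \<in> L" "e \<noteq> e'" using obtain_two_elements[OF two] .
      then have n: "e \<in> nsets Q 2" "e' \<in> nsets Q 2" using assms(3) by auto
      have "card (e \<union> e') \<ge> 3"
      proof (rule ccontr)
        assume "\<not> card (e \<union> e') \<ge> 3"
        then have "card (e \<union> e') \<le> card e" "card (e \<union> e') \<le> card e'" "finite (e \<union> e')"
          using n by (auto simp: nsets_def)
        then show False using card_seteq[of "e \<union> e'"] ee(3) by (metis Un_upper1 Un_upper2)
      qed
      then have "(card Q - card (e \<union> e') choose 3) \<le> (r + 3 choose 3)"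
        using assms(2) by (intro binomial_right_mono) auto
      with card_transversals_miss2[OF assms(1) ee(1,2) n, of 3]
      have "c + 2 * (r + 4 choose 3) \<le> (r + 6 choose 3) + (r + 3 choose 3)"
        using c assms(2) by (simp add: add.commute)
      then show ?thesis using ch by linarith
    qed
    moreover have "(r + 6) * (r + 2) + 4 = (r + 4) * (r + 4)" by (simp add: algebra_simps)
    ultimately show ?thesis using 1 by auto
  next
    case 2
    have "c \<le> card {v \<in> nsets Q (card X + 2). X \<subseteq> v}"
      unfolding c_def 2 using assms(1) transversals_subset[of Q 3 L]
      by (intro card_mono) (auto simp: finite_imp_finite_nsets eval_nat_numeral)
    also have "\<dots> \<le> (r + 5 choose 2)"
      using card_supersets_le[OF assms(1,5), of 2] 2 assms(2) by (simp add: add.commute)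
    finally have "2 * c \<le> (r + 5) * (r + 4)" using ch by linarith
    then have "c + (r + 2) * card X \<le> (r + 6) * (r + 2) + 1" using 2 by (simp add: algebra_simps)
    then show ?thesis by simp
  next
    case 3
    obtain Y where Y: "Y \<subseteq> X" "card Y = 2" using obtain_subset_with_card_n[OF 3(1)] by metis
    have "c \<le> card {v \<in> nsets Q (card Y + 1). Y \<subseteq> v}"
      unfolding c_def Y(2) using assms(1) transversals_subset[of Q 3 L] Y(1)
      by (intro card_mono) (auto simp: finite_imp_finite_nsets eval_nat_numeral)
    also have "\<dots> \<le> r + 4"
      using card_supersets_le[OF assms(1), of Y 1] Y assms(2,5) by (simp add: add.commute)
    finally have "c \<le> r + 4" .
    moreover have "(r + 2) * card X \<le> (r + 2) * 3" using 3 by (intro mult_left_mono) auto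
    ultimately have "c + (r + 2) * card X \<le> (r + 6) * (r + 2) + 1" by (simp add: algebra_simps)
    then show ?thesis by simp
  next
    case 4
    have "\<not> X \<subseteq> v" if "v \<in> transversals Q 3 L" for v
    proof
      assume "X \<subseteq> v"
      moreover have "finite v" "card v = 3" using that by (auto simp: transversals_def nsets_def)
      ultimately show False using card_mono[of v X] 4 by simp
    qed
    then have "c = 0" by (auto simp: c_def card_eq_0_iff)
    moreover have "card X \<le> r + 6" using card_mono[OF assms(1,5)] assms(2) by simp
    then have "(r + 2) * card X \<le> (r + 2) * (r + 6)" by (intro mult_left_mono) auto
    ultimately have "c + (r + 2) * card X \<le> (r + 6) * (r + 2) + 1" by (simp add: mult.commute)
    then show ?thesis by simp
  qed
  then show "c + (r + 2) * card X \<le> (r + 6) * (r + 2) + 4"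
    and "card L \<ge> 2 \<Longrightarrow> c + (r + 2) * card X \<le> (r + 6) * (r + 2) + 1" by auto
qed

text \<open>\<open>l1\<close> and \<open>l2\<close> stand for the sizes of the two links,
  \<open>k1\<close> and \<open>k2\<close> for their numbers of transversal pairs, \<open>x\<close>
  for the size of \<open>X\<close>, and \<open>c\<close> for the transversals avoiding both covering
  points. In the first and third cases of the proof the estimates add up to exactly the right-hand
  side; the third relies on the sharper bound for \<open>c\<close>.\<close>

lemma two_cover_arith:
  fixes r :: nat
  assumes "l1 \<le> l2" "1 \<le> l1" "l1 \<le> k2" "l2 \<le> k1"
    and "k1 \<le> 2 * r + 9" "k2 \<le> 2 * r + 9"
    and "2 \<le> l1 \<Longrightarrow> k1 \<le> r + 6" "2 \<le> l2 \<Longrightarrow> k2 \<le> r + 6"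
    and "3 \<le> l1 \<Longrightarrow> k1 \<le> r + 5" "3 \<le> l2 \<Longrightarrow> k2 \<le> r + 5"
    and "3 \<le> l2 \<Longrightarrow> k2 \<le> 4 \<or> l2 \<le> r + 5"
    and "c + (r + 2) * x \<le> (r + 6) * (r + 2) + 4"
    and "2 \<le> l2 \<Longrightarrow> c + (r + 2) * x \<le> (r + 6) * (r + 2) + 1"
  shows "(r + 2) * (x + l1 + l2) + (r + 6 + k1 + k2 + c) \<le> (r + 3) * (3 * r + 16) + 4"
proof -
  have goal: ?thesis if "l1 + l2 \<le> s" "k1 + k2 \<le> k" "c + (r + 2) * x \<le> (r + 6) * (r + 2) + d"
     "(r + 2) * s + k + (r + 6) * (r + 2) + d + r + 6 \<le> (r + 3) * (3 * r + 16) + 4" for s k d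
  proof -
    have "(r + 2) * (l1 + l2) \<le> (r + 2) * s" using that(1) by (intro mult_left_mono) auto
    then show ?thesis using that by (simp add: distrib_left)
  qed
  consider "3 \<le> l1" | "l1 = 2" | "l1 = 1" "3 \<le> l2" "k2 \<le> 4" | "l1 = 1" "l2 \<le> r + 5"
    using assms by linarith
  then show ?thesis
  proof cases
    case 1
    show ?thesis by (rule goal[of "2 * r + 10" "2 * r + 10" 4]) (use 1 assms in \<open>auto simp: algebra_simps\<close>)
  next
    case 2
    show ?thesis by (rule goal[of "r + 8" "2 * r + 12" 4]) (use 2 assms in \<open>auto simp: algebra_simps\<close>)
  next
    case 3
    show ?thesis by (rule goal[of "2 * r + 10" "2 * r + 13" 1]) (use 3 assms in \<open>auto simp: algebra_simps\<close>)
  next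
    case 4
    show ?thesis by (rule goal[of "r + 6" "4 * r + 18" 4]) (use 4 assms in \<open>auto simp: algebra_simps\<close>)
  qed
qed

text \<open>Members and transversals are split by their intersection with \<open>{p, q}\<close>. A
  transversal containing only \<open>p\<close> has to meet the link of \<open>q\<close>, and
  conversely; one containing neither meets both links and includes \<open>X\<close>. As
  \<open>F\<close> is intersecting, each link consists of transversals of the other.\<close>

lemma intersecting_two_cover_bound:
  assumes "finite S" "card S = r + 8" "F \<subseteq> nsets S 3"
    and inter: "\<And>u w. u \<in> F \<Longrightarrow> w \<in> F \<Longrightarrow> u \<inter> w \<noteq> {}"
    and pq: "p \<in> S" "q \<in> S" "p \<noteq> q" "\<And>u. u \<in> F \<Longrightarrow> p \<in> u \<or> q \<in> u"
    and nonstar: "\<exists>u\<in>F. p \<notin> u" "\<exists>u\<in>F. q \<notin> u"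
  shows "(r + 2) * card F + card (transversals S 3 F) \<le> (r + 3) * (3 * r + 16) + 4"
proof -
  define Q where "Q = S - {p, q}"
  \<comment> \<open>Edges are taken inside \<open>Q\<close>, so \<open>link p\<close> stems from the
    members containing \<open>p\<close> but not \<open>q\<close>.\<close>
  define link where "link z = {e \<in> nsets Q 2. insert z e \<in> F}" for z
  define X where "X = {y \<in> Q. {p, q, y} \<in> F}"
  let ?T = "transversals S 3 F"
  define R where "R = {v \<in> transversals Q 3 (link p \<union> link q). X \<subseteq> v}"
  have finQ: "finite Q" "card Q = r + 6" using assms by (auto simp: Q_def)
  have finX: "finite X" "X \<subseteq> Q" using finQ by (auto simp: X_def)
  have link: "link z \<subseteq> nsets Q 2" "finite (link z)" for z
    using finQ by (auto simp: link_def finite_imp_finite_nsets)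
  have FT: "u \<in> ?T" if "u \<in> F" for u using that assms(3) inter by (fastforce simp: transversals_def)
  have split: "u \<in> (\<lambda>y. {p, q, y}) ` Q \<or> u \<in> insert p ` transversals Q 2 (link q)
      \<or> u \<in> insert q ` transversals Q 2 (link p) \<or> u \<in> R" if u: "u \<in> ?T" for u
  proof -
    have cu: "card u = 3" "finite u" "u \<subseteq> S" using u by (auto simp: transversals_def nsets_def)
    have one: "u - {a} \<in> transversals Q 2 (link b)" if ab: "a \<in> u" "b \<notin> u" "{a, b} = {p, q}" for a b
    proof -
      have "u - {a} \<in> nsets Q 2" using cu ab by (auto simp: nsets_def Q_def)
      moreover have "(u - {a}) \<inter> e \<noteq> {}" if e: "e \<in> link b" for e
      proof -
        have "insert b e \<in> F" "a \<notin> e" using e ab(3) by (auto simp: link_def nsets_def Q_def)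
        moreover obtain y where "y \<in> insert b e" "y \<in> u" using transversals_meets[OF u] calculation by blast
        ultimately show ?thesis using ab by auto
      qed
      ultimately show ?thesis by (auto simp: transversals_def)
    qed
    consider "p \<in> u" "q \<in> u" | "p \<in> u" "q \<notin> u" | "p \<notin> u" "q \<in> u" | "p \<notin> u" "q \<notin> u" by blast
    then show ?thesis
    proof cases
      case 1
      then have "card (u - {p, q}) = 1" using cu pq by (simp add: card_Diff_subset)
      then obtain y where y: "u - {p, q} = {y}" by (metis card_1_singletonE)
      then have "u = {p, q, y}" "y \<in> Q" using 1 cu by (auto simp: Q_def)
      then show ?thesis by blast
    next
      case 2
      then have "u - {p} \<in> transversals Q 2 (link q)" "u = insert p (u - {p})" using one by auto
      then show ?thesis by blast
    next
      case 3
      then have "u - {q} \<in> transversals Q 2 (link p)" "u = insert q (u - {q})" using one by auto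
      then show ?thesis by blast
    next
      case 4
      then have "u \<in> nsets Q 3" using cu by (auto simp: nsets_def Q_def)
      moreover have "e \<inter> u \<noteq> {}" if "e \<in> link p \<union> link q" for e
      proof -
        obtain z where z: "insert z e \<in> F" "z \<notin> u" using \<open>e \<in> link p \<union> link q\<close> 4 by (auto simp: link_def)
        obtain y where "y \<in> insert z e" "y \<in> u" using transversals_meets[OF u z(1)] .
        then show ?thesis using z by auto
      qed
      moreover have "X \<subseteq> u"
      proof
        fix x assume "x \<in> X"
        then have "{p, q, x} \<in> F" by (simp add: X_def)
        from transversals_meets[OF u this] show "x \<in> u" using 4 by blast
      qed
      ultimately show ?thesis by (auto simp: R_def transversals_def)
    qed
  qed
  have splitF: "u \<in> (\<lambda>y. {p, q, y}) ` X \<or> u \<in> insert p ` link p \<or> u \<in> insert q ` link q" if u: "u \<in> F" for u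
  proof -
    have cu: "card u = 3" "finite u" "u \<subseteq> S" using u assms(3) by (auto simp: nsets_def)
    have one: "u \<in> insert a ` link a" if ab: "a \<in> u" "b \<notin> u" "{a, b} = {p, q}" for a b
    proof -
      have "u - {a} \<in> nsets Q 2" "insert a (u - {a}) = u" using cu ab by (auto simp: nsets_def Q_def)
      then have "u - {a} \<in> link a" "u = insert a (u - {a})" using u by (auto simp: link_def)
      then show ?thesis by blast
    qed
    consider "p \<in> u" "q \<in> u" | "p \<in> u" "q \<notin> u" | "p \<notin> u" "q \<in> u" using pq(4)[OF u] by blast
    then show ?thesis
    proof cases
      case 1
      then have "card (u - {p, q}) = 1" using cu pq by (simp add: card_Diff_subset)
      then obtain y where y: "u - {p, q} = {y}" by (metis card_1_singletonE)
      then have "u = {p, q, y}" "y \<in> Q" using 1 cu by (auto simp: Q_def)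
      then show ?thesis using u by (auto simp: X_def)
    qed (use one[of p q] one[of q p] in auto)
  qed
  have ne: "link p \<noteq> {}" "link q \<noteq> {}"
    using nonstar splitF by blast+
  have cross: "link p \<subseteq> transversals Q 2 (link q)" "link q \<subseteq> transversals Q 2 (link p)"
  proof -
    have "e \<inter> f \<noteq> {}" if "e \<in> link p" "f \<in> link q" for e f
    proof -
      have "insert p e \<in> F" "insert q f \<in> F" "p \<notin> f" "q \<notin> e"
        using that by (auto simp: link_def nsets_def Q_def)
      then show ?thesis using inter[of "insert p e" "insert q f"] pq(3) by auto
    qed
    then show "link p \<subseteq> transversals Q 2 (link q)" "link q \<subseteq> transversals Q 2 (link p)"
      using link unfolding transversals_def by (blast, blast)
  qed
  define c where "c = card R"
  define l where "l z = card (link z)" for z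
  define k where "k z = card (transversals Q 2 (link z))" for z
  have lk: "l p \<le> k q" "l q \<le> k p" using cross finQ by (auto simp: l_def k_def intro: card_mono)
  have l1: "1 \<le> l p" "1 \<le> l q" using ne link by (auto simp: l_def Suc_le_eq card_gt_0_iff)
  have big: "6 \<le> card Q" using finQ by simp
  note kp = card_transversals_pairs[OF finQ(1) link(1) ne(1) big, folded k_def l_def, unfolded finQ(2)]
  note kq = card_transversals_pairs[OF finQ(1) link(1) ne(2) big, folded k_def l_def, unfolded finQ(2)]
  have un: "link p \<union> link q \<subseteq> nsets Q 2" "link p \<union> link q \<noteq> {}" using link ne by auto
  have lun: "l p \<le> card (link p \<union> link q)" "l q \<le> card (link p \<union> link q)"
    unfolding l_def using link by (auto intro: card_mono)
  note cc = card_transversals_supersets[OF finQ un finX(2), folded R_def, folded c_def]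
  have N: "card ?T \<le> r + 6 + k p + k q + c"
  proof -
    have "?T \<subseteq> (\<lambda>y. {p, q, y}) ` Q \<union> (insert p ` transversals Q 2 (link q)
        \<union> (insert q ` transversals Q 2 (link p) \<union> R))" using split by blast
    then have "card ?T \<le> card ((\<lambda>y. {p, q, y}) ` Q \<union> (insert p ` transversals Q 2 (link q)
        \<union> (insert q ` transversals Q 2 (link p) \<union> R)))"
      using finQ by (intro card_mono) (auto simp: R_def)
    also have "\<dots> \<le> card ((\<lambda>y. {p, q, y}) ` Q) + (card (insert p ` transversals Q 2 (link q))
        + (card (insert q ` transversals Q 2 (link p)) + card R))"
      by (meson card_Un_le add_left_mono le_trans)
    also have "\<dots> \<le> card Q + (k q + (k p + c))"
      unfolding k_def c_def using finQ by (intro add_mono card_image_le) auto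
    finally show ?thesis using finQ by simp
  qed
  have Fc: "card F \<le> card X + l p + l q"
  proof -
    have "F \<subseteq> (\<lambda>y. {p, q, y}) ` X \<union> (insert p ` link p \<union> insert q ` link q)" using splitF by blast
    then have "card F \<le> card ((\<lambda>y. {p, q, y}) ` X \<union> (insert p ` link p \<union> insert q ` link q))"
      using finX link by (intro card_mono) auto
    also have "\<dots> \<le> card ((\<lambda>y. {p, q, y}) ` X) + (card (insert p ` link p) + card (insert q ` link q))"
      by (meson card_Un_le add_left_mono le_trans)
    also have "\<dots> \<le> card X + (l p + l q)"
      unfolding l_def using finX link by (intro add_mono card_image_le) auto
    finally show ?thesis by simp
  qed
  have "(r + 2) * (card X + l p + l q) + (r + 6 + k p + k q + c) \<le> (r + 3) * (3 * r + 16) + 4"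
  proof (cases "l p \<le> l q")
    case True
    show ?thesis
      by (rule two_cover_arith) (use True lk l1 kp kq cc lun in auto)
  next
    case False
    have "(r + 2) * (card X + l q + l p) + (r + 6 + k q + k p + c) \<le> (r + 3) * (3 * r + 16) + 4"
      by (rule two_cover_arith) (use False lk l1 kp kq cc lun in auto)
    then show ?thesis by (simp add: algebra_simps)
  qed
  moreover have "(r + 2) * card F \<le> (r + 2) * (card X + l p + l q)" using Fc by (intro mult_left_mono) auto
  ultimately show ?thesis using N by linarith
qed

section \<open>Numerical inequalities for the class bounds\<close>

lemma six_choose_three_nat:
  assumes "n = m + 2"
  shows "6 * (n choose 3) = n * (m + 1) * m"
proof -
  have "int (6 * (n choose 3)) = int (n * (m + 1) * m)"
    using six_choose_three[of n] assms by (simp add: algebra_simps)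
  then show ?thesis using of_nat_eq_iff by blast
qed

lemma two_choose_two_nat: "2 * (m + 1 choose 2) = (m + 1) * m"
proof -
  have "int (2 * (m + 1 choose 2)) = int ((m + 1) * m)"
    using two_choose_two[of "m + 1"] by (simp add: algebra_simps)
  then show ?thesis using of_nat_eq_iff by blast
qed

text \<open>With ground set of size \<open>r + 8\<close>, a slack of \<open>r + 4\<close> for \<open>r = 2, 3\<close> outweighs the deficit of
  the at most \<open>r + 3\<close> exceptional star classes.\<close>
definition slack :: "nat \<Rightarrow> nat" where
  "slack r = (if r \<le> 1 then 1 else r + 4)"

text \<open>The first two inequalities serve families that are not stars. The other six match the
  last six alternatives of \<open>star_link_cases\<close>, after cancelling the C(r+7,2) triples
  through the centre.\<close>

lemma slack_arith:
  "21 + (r + 2) * 16 + slack r \<le> r + 8 choose 3"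
  "(r + 3) * (3 * r + 16) + 4 + slack r \<le> r + 8 choose 3"
  "r + 5 + (r + 2) * (2 * r + 11) + slack r \<le> r + 7 choose 3"
  "2 + (r + 2) * (2 * r + 14) + slack r \<le> r + 7 choose 3"
  "(r + 6 choose 2) + (r + 2) * (r + 6) + slack r \<le> r + 7 choose 3"
  "2 * r + 9 + (r + 2) * (r + 12) + slack r \<le> r + 7 choose 3"
  "(r + 2) * 3 + slack r \<le> r + 5 choose 3"
  "(r + 2) * 9 + slack r + (r + 3 choose 3) \<le> 2 * (r + 5 choose 3)"
proof -
  have c: "6 * (r + 8 choose 3) = (r + 8) * (r + 7) * (r + 6)" "6 * (r + 7 choose 3) = (r + 7) * (r + 6) * (r + 5)"
    "6 * (r + 5 choose 3) = (r + 5) * (r + 4) * (r + 3)" "6 * (r + 3 choose 3) = (r + 3) * (r + 2) * (r + 1)"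
    "2 * (r + 6 choose 2) = (r + 6) * (r + 5)"
    using six_choose_three_nat[of "r + 8" "r + 6"] six_choose_three_nat[of "r + 7" "r + 5"]
      six_choose_three_nat[of "r + 5" "r + 3"] six_choose_three_nat[of "r + 3" "r + 1"]
      two_choose_two_nat[of "r + 5"]
    by (simp_all add: algebra_simps)
  \<comment> \<open>\<open>slack\<close> changes form at 2; for \<open>r = s + 2\<close> it equals
    \<open>s + 6\<close>.\<close>
  have "r = 0 \<or> r = 1 \<or> (\<exists>s. r = s + 2)" by presburger
  then consider "r = 0" | "r = 1" | s where "r = s + 2" by blast
  note cases = this
  show "21 + (r + 2) * 16 + slack r \<le> r + 8 choose 3"
    using c by (cases rule: cases) (auto simp: slack_def algebra_simps)
  show "(r + 3) * (3 * r + 16) + 4 + slack r \<le> r + 8 choose 3"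
    using c by (cases rule: cases) (auto simp: slack_def algebra_simps)
  show "r + 5 + (r + 2) * (2 * r + 11) + slack r \<le> r + 7 choose 3"
    using c by (cases rule: cases) (auto simp: slack_def algebra_simps)
  show "2 + (r + 2) * (2 * r + 14) + slack r \<le> r + 7 choose 3"
    using c by (cases rule: cases) (auto simp: slack_def algebra_simps)
  show "(r + 6 choose 2) + (r + 2) * (r + 6) + slack r \<le> r + 7 choose 3"
    using c by (cases rule: cases) (auto simp: slack_def algebra_simps)
  show "2 * r + 9 + (r + 2) * (r + 12) + slack r \<le> r + 7 choose 3"
    using c by (cases rule: cases) (auto simp: slack_def algebra_simps)
  show "(r + 2) * 3 + slack r \<le> r + 5 choose 3"
    using c by (cases rule: cases) (auto simp: slack_def algebra_simps)
  show "(r + 2) * 9 + slack r + (r + 3 choose 3) \<le> 2 * (r + 5 choose 3)"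
    using c by (cases rule: cases) (auto simp: slack_def algebra_simps)
qed

text \<open>\<open>3 * r + 15\<close> and \<open>(r + 7 choose 2) + 1\<close> bound the size and the
  transversals of a maximal covered star, and the summand 2 makes its excess at least 1. For
  \<open>r = 2\<close> and \<open>r = 3\<close> these bounds give only -1.\<close>

lemma full_star_arith:
  assumes "\<not> (r = 2 \<or> r = 3)"
  shows "(r + 2) * (3 * r + 15) + (r + 7 choose 2) + 2 \<le> r + 8 choose 3"
proof -
  have c: "6 * (r + 7 choose 3) = (r + 7) * (r + 6) * (r + 5)"
    using six_choose_three_nat[of "r + 7" "r + 5"] by (simp add: algebra_simps)
  have "r = 0 \<or> r = 1 \<or> (\<exists>s. r = s + 4)" using assms by presburger
  then consider "r = 0" | "r = 1" | s where "r = s + 4" by blast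
  then have "(r + 2) * (3 * r + 15) + 2 \<le> r + 7 choose 3"
    using c by cases (auto simp: algebra_simps)
  moreover have "r + 8 choose 3 = (r + 7 choose 3) + (r + 7 choose 2)" by (simp add: numeral_eq_Suc)
  ultimately show ?thesis by simp
qed

section \<open>Bounds for a single colour class\<close>

text \<open>At most C(r+7,2) transversals contain the centre \<open>x\<close>; those avoiding it are
  transversals of the link \<open>G\<close>. By Pascal's rule C(r+7,3) remains for the latter and
  for the term in \<open>card F\<close>. The first alternative of \<open>star_link_cases\<close>
  becomes the second one here.\<close>

lemma star_class_bound:
  assumes "finite S" "card S = r + 8" "F \<subseteq> nsets S 3" "F \<noteq> {}"
    and star: "\<And>u. u \<in> F \<Longrightarrow> x \<in> u"
    and v: "v \<in> transversals S 3 F" "x \<notin> v"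
  shows "card (transversals S 3 F) + (r + 2) * card F + slack r \<le> r + 8 choose 3
    \<or> card F \<le> 3 * r + 15 \<and> card (transversals S 3 F) \<le> (r + 7 choose 2) + 1"
proof -
  define Q where "Q = S - {x}"
  define G where "G = (\<lambda>u. u - {x}) ` F"
  let ?T = "transversals S 3 F"
  let ?t = "card (transversals Q 3 G)"
  have "x \<in> S" using assms(3,4) star by (fastforce simp: nsets_def)
  then have Q: "finite Q" "card Q = r + 7" using assms by (auto simp: Q_def)
  have G: "G \<subseteq> nsets Q 2" "G \<noteq> {}"
    using assms(3,4) star by (auto simp: G_def Q_def nsets_def)
  have cG: "card G = card F"
    unfolding G_def by (intro card_image inj_onI) (metis insert_Diff star)
  have vG: "v \<in> transversals Q 3 G"
    using v by (auto simp: transversals_def nsets_def G_def Q_def)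
  have "?T \<subseteq> insert x ` nsets Q 2 \<union> transversals Q 3 G"
  proof
    fix u assume u: "u \<in> ?T"
    then have cu: "card u = 3" "finite u" "u \<subseteq> S" by (auto simp: transversals_def nsets_def)
    show "u \<in> insert x ` nsets Q 2 \<union> transversals Q 3 G"
    proof (cases "x \<in> u")
      case True
      then have "u - {x} \<in> nsets Q 2" "u = insert x (u - {x})" using cu by (auto simp: nsets_def Q_def)
      then show ?thesis by blast
    next
      case False
      then show ?thesis using u by (auto simp: transversals_def nsets_def G_def Q_def)
    qed
  qed
  then have "card ?T \<le> card (insert x ` nsets Q 2 \<union> transversals Q 3 G)"
    using Q by (intro card_mono) (auto simp: finite_imp_finite_nsets)
  also have "\<dots> \<le> card (insert x ` nsets Q 2) + ?t" by (rule card_Un_le)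
  also have "card (insert x ` nsets Q 2) \<le> (r + 7 choose 2)"
    using Q card_image_le[of "nsets Q 2" "insert x"] by (simp add: finite_imp_finite_nsets)
  finally have N: "card ?T \<le> (r + 7 choose 2) + ?t" by simp
  have choose: "r + 8 choose 3 = (r + 7 choose 3) + (r + 7 choose 2)"
    by (simp add: numeral_eq_Suc)
  have first: ?thesis if "card G \<le> f" "?t + (r + 2) * f + slack r \<le> r + 7 choose 3" for f
  proof -
    have "(r + 2) * card F \<le> (r + 2) * f" using that(1) cG by (intro mult_left_mono) auto
    then show ?thesis using that(2) N choose by linarith
  qed
  from star_link_cases[OF Q(1) G Q(2) vG]
  consider "card G \<le> 3 * r + 15" "?t \<le> 1"
    | "card G \<le> 2 * r + 11" "?t \<le> r + 5"
    | "card G \<le> 2 * r + 14" "?t \<le> 2"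
    | "card G \<le> r + 6" "?t \<le> (r + 6 choose 2)"
    | "card G \<le> r + 12" "?t \<le> 2 * r + 9"
    | "card G \<le> 3" "?t + (r + 5 choose 3) \<le> (r + 7 choose 3)"
    | "card G \<le> 9" "?t + 2 * (r + 5 choose 3) \<le> (r + 7 choose 3) + (r + 3 choose 3)"
    by blast
  then show ?thesis
  proof cases
    case 1
    then show ?thesis using N cG by auto
  qed (use slack_arith(3-8)[of r] first in \<open>fastforce\<close>)+
qed

text \<open>Three kinds of family: stars, other families covered by two points, and the rest. Only
  stars lead to the second alternative.\<close>

lemma intersecting_class_bound:
  assumes "finite S" "card S = r + 8" "F \<subseteq> nsets S 3" "F \<noteq> {}"
    and inter: "\<And>u w. u \<in> F \<Longrightarrow> w \<in> F \<Longrightarrow> u \<inter> w \<noteq> {}"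
    and star: "\<And>x. x \<in> S \<Longrightarrow> (\<And>u. u \<in> F \<Longrightarrow> x \<in> u) \<Longrightarrow> \<exists>v\<in>transversals S 3 F. x \<notin> v"
  shows "card (transversals S 3 F) + (r + 2) * card F + slack r \<le> r + 8 choose 3
    \<or> card F \<le> 3 * r + 15 \<and> card (transversals S 3 F) \<le> (r + 7 choose 2) + 1"
proof (cases "\<exists>x\<in>S. \<forall>u\<in>F. x \<in> u")
  case True
  then obtain x v where "\<And>u. u \<in> F \<Longrightarrow> x \<in> u" "v \<in> transversals S 3 F" "x \<notin> v" using star by metis
  then show ?thesis using star_class_bound[OF assms(1-4)] by blast
next
  case nonstar: False
  show ?thesis
  proof (cases "\<exists>p\<in>S. \<exists>q\<in>S. p \<noteq> q \<and> (\<forall>u\<in>F. p \<in> u \<or> q \<in> u)")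
    case True
    then obtain p q where pq: "p \<in> S" "q \<in> S" "p \<noteq> q" "\<And>u. u \<in> F \<Longrightarrow> p \<in> u \<or> q \<in> u" by blast
    have "(r + 2) * card F + card (transversals S 3 F) \<le> (r + 3) * (3 * r + 16) + 4"
      using nonstar pq(1,2) by (intro intersecting_two_cover_bound[OF assms(1-3) inter pq]) auto
    then show ?thesis using slack_arith(2)[of r] by linarith
  next
    case False
    have "card (transversals S 3 F) \<le> 21" "card F \<le> 16"
      using False by (intro intersecting_no_two_cover_bound[OF assms(1,3,4) inter]; blast)+
    moreover from this have "(r + 2) * card F \<le> (r + 2) * 16" by (intro mult_left_mono) auto
    ultimately show ?thesis using slack_arith(1)[of r] by linarith
  qed
qed

text \<open>For ground sets of size 10 and 11 a maximal covered star has excess \<open>-1\<close>. There are at most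
  \<open>m\<close> such stars, so one class with excess above \<open>m\<close> compensates for them; without such a class
  there are more than \<open>m\<close> classes, which is already too many.\<close>
lemma sum_excess_pos:
  fixes e f :: "'i \<Rightarrow> int"
  assumes "finite I" "(\<Sum>i\<in>I. f i) = C"
    and f: "\<And>i. i \<in> I \<Longrightarrow> f i \<ge> 0"
    and alt: "\<And>i. i \<in> I \<Longrightarrow> e i \<ge> m + 1 \<or> f i \<le> b \<and> e i \<ge> g - k * f i"
    and par: "0 \<le> k" "0 \<le> m" "0 \<le> b" "0 \<le> g" "k * b \<le> g + 1" "k * (b - 1) \<le> g"
      "m * b < C" "C < (m + 1) * b" "k * C < (m + 1) * g"
  shows "(\<Sum>i\<in>I. e i) > 0"
proof (cases "\<exists>i\<in>I. e i \<ge> m + 1")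
  case True
  then obtain i0 where i0: "i0 \<in> I" "e i0 \<ge> m + 1" by blast
  define J where "J = {i \<in> I. e i < 0}"
  have J: "finite J" "J \<subseteq> I" using assms(1) by (auto simp: J_def)
  \<comment> \<open>With fewer than \<open>b\<close> members, \<open>k * (b - 1) \<le> g\<close>
    would make the excess nonnegative. So a negative class has exactly \<open>b\<close> members, and
    \<open>k * b \<le> g + 1\<close> limits its deficit to 1.\<close>
  have Jf: "f i \<ge> b \<and> e i \<ge> -1" if "i \<in> J" for i
  proof -
    have i: "f i \<le> b" "e i \<ge> g - k * f i" "e i < 0" using that alt[of i] par(2) by (auto simp: J_def)
    have "k * f i \<le> k * b" using i par(1) by (intro mult_left_mono)
    moreover have "f i \<ge> b"
    proof (rule ccontr)
      assume "\<not> f i \<ge> b"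
      then have "k * f i \<le> k * (b - 1)" using par(1) by (intro mult_left_mono) auto
      then show False using i par by linarith
    qed
    ultimately show ?thesis using i par by linarith
  qed
  \<comment> \<open>Since \<open>C < (m + 1) * b\<close>, at most \<open>m\<close> classes are
    negative, and \<open>i0\<close> alone outweighs them.\<close>
  have "int (card J) * b = (\<Sum>i\<in>J. b)" by simp
  also have "\<dots> \<le> (\<Sum>i\<in>J. f i)" using Jf by (intro sum_mono) auto
  also have "\<dots> \<le> (\<Sum>i\<in>I. f i)" using J f assms(1) by (intro sum_mono2) auto
  finally have "int (card J) * b < (m + 1) * b" using assms(2) par by simp
  then have "int (card J) < m + 1" using par(3) by (simp add: mult_less_cancel_right)
  moreover have "(\<Sum>i\<in>J. e i) \<ge> (\<Sum>i\<in>J. -1)" using Jf by (intro sum_mono) auto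
  moreover have "(\<Sum>i\<in>I. e i) = (\<Sum>i\<in>I - J. e i) + (\<Sum>i\<in>J. e i)"
    using sum.subset_diff[OF J(2) assms(1)] by blast
  moreover have "i0 \<in> I - J" using i0 par(2) by (auto simp: J_def)
  then have "e i0 \<le> (\<Sum>i\<in>I - J. e i)"
    using assms(1) by (intro member_le_sum) (auto simp: J_def)
  ultimately show ?thesis using i0 by simp
next
  case False
  then have all: "f i \<le> b \<and> e i \<ge> g - k * f i" if "i \<in> I" for i using alt that by blast
  \<comment> \<open>Classes of size at most \<open>b\<close> with total above \<open>m * b\<close>
    number at least \<open>m + 1\<close>, and \<open>(m + 1) * g\<close> exceeds
    \<open>k * C\<close>.\<close>
  have "C \<le> (\<Sum>i\<in>I. b)" unfolding assms(2)[symmetric] using all by (intro sum_mono) auto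
  then have "m * b < int (card I) * b" using par by simp
  then have "m < int (card I)" using par(3) by (simp add: mult_less_cancel_right)
  then have "(m + 1) * g \<le> int (card I) * g" using par(4) by (intro mult_right_mono) auto
  moreover have "(\<Sum>i\<in>I. g - k * f i) \<le> (\<Sum>i\<in>I. e i)" using all by (intro sum_mono) auto
  moreover have "(\<Sum>i\<in>I. g - k * f i) = int (card I) * g - k * C"
    by (simp add: sum_subtractf assms(2) flip: sum_distrib_left)
  ultimately show ?thesis using par by linarith
qed

section \<open>Colours seen from a triple\<close>

text \<open>The colours on the open neighbourhood of \<open>v\<close> in the Kneser graph on
  \<open>S\<close>. The ground set is a parameter because the induction deletes points while keeping
  the colouring.\<close>

definition seen :: "'a set \<Rightarrow> ('a set \<Rightarrow> 'b) \<Rightarrow> 'a set \<Rightarrow> 'b set" where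
  "seen S c v = c ` {u \<in> nsets S 3. u \<inter> v = {}}"

lemma finite_seen [simp]: "finite S \<Longrightarrow> finite (seen S c v)"
  by (simp add: seen_def finite_imp_finite_nsets)

lemma six_points_seen:
  assumes "finite S" "card S = 6"
  shows "\<exists>v\<in>nsets S 3. 1 \<le> card (seen S c v)"
proof -
  obtain v where v: "v \<subseteq> S" "card v = 3" "finite v"
    using obtain_subset_with_card_n[of 3 S] assms by auto
  then have "S - v \<in> nsets S 3" using assms by (auto simp: nsets_def card_Diff_subset)
  then have "c (S - v) \<in> seen S c v" by (auto simp: seen_def)
  then have "card (seen S c v) \<noteq> 0" using assms(1) by (auto simp: card_eq_0_iff)
  then show ?thesis using v by (auto simp: nsets_def intro!: bexI[of _ v])
qed

text \<open>Uses a 7-cycle of the graph: if every vertex saw only one colour, vertices at distance two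
  on the cycle would share their colour, hence all of them would.\<close>
lemma seven_points_seen:
  assumes "finite S" "card S = 7"
    and proper: "\<And>u w. u \<in> nsets S 3 \<Longrightarrow> w \<in> nsets S 3 \<Longrightarrow> u \<inter> w = {} \<Longrightarrow> c u \<noteq> c w"
  shows "\<exists>v\<in>nsets S 3. 2 \<le> card (seen S c v)"
proof (rule ccontr)
  assume neg: "\<not> ?thesis"
  have same: "c u = c w" if "u \<in> nsets S 3" "w \<in> nsets S 3" "v \<in> nsets S 3" "u \<inter> v = {}" "w \<inter> v = {}" for u w v
  proof -
    have "card (seen S c v) \<le> Suc 0" using neg that by force
    moreover have "c u \<in> seen S c v" "c w \<in> seen S c v" using that by (auto simp: seen_def)
    ultimately show ?thesis using assms(1) card_le_Suc0_iff_eq[of "seen S c v"] by auto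
  qed
  obtain xs where xs: "set xs = S" "distinct xs" using finite_distinct_list[OF assms(1)] by blast
  then have "length xs = 7" using assms(2) distinct_card by metis
  then obtain x1 x2 x3 x4 x5 x6 x7 where x: "xs = [x1, x2, x3, x4, x5, x6, x7]"
    by (auto simp: length_Suc_conv eval_nat_numeral)
  have dist: "distinct [x1, x2, x3, x4, x5, x6, x7]" and S: "S = {x1, x2, x3, x4, x5, x6, x7}"
    using xs x by auto
  \<comment> \<open>The cycle is 123, 567, 124, 367, 145, 237, 456. Each equation compares the two
    neighbours of a cycle vertex, and 456 is adjacent to 123.\<close>
  have "c {x1, x2, x3} = c {x1, x2, x4}"
    by (rule same[of _ _ "{x5, x6, x7}"]) (use dist in \<open>simp_all add: S nsets_def\<close>)
  also have "\<dots> = c {x1, x4, x5}"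
    by (rule same[of _ _ "{x3, x6, x7}"]) (use dist in \<open>simp_all add: S nsets_def\<close>)
  also have "\<dots> = c {x4, x5, x6}"
    by (rule same[of _ _ "{x2, x3, x7}"]) (use dist in \<open>simp_all add: S nsets_def\<close>)
  finally show False
    using proper[of "{x1, x2, x3}" "{x4, x5, x6}"] dist by (auto simp: S nsets_def)
qed

lemma exists_vertex_seeing_many:
  assumes "finite S" "card S \<ge> 6"
    and "\<And>u w. u \<in> nsets S 3 \<Longrightarrow> w \<in> nsets S 3 \<Longrightarrow> u \<inter> w = {} \<Longrightarrow> c u \<noteq> c w"
  shows "\<exists>v\<in>nsets S 3. card S - 5 \<le> card (seen S c v)"
  using assms
proof (induction "card S" arbitrary: S rule: less_induct)
  case less
  note proper = less.prems(3)
  consider "card S = 6" | "card S = 7" | "card S \<ge> 8" using less.prems by linarith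
  then show ?case
  proof cases
    case 1
    then show ?thesis using six_points_seen[OF less.prems(1)] by simp
  next
    case 2
    then show ?thesis using seven_points_seen[OF less.prems(1) _ proper] by simp
  next
    case 3
    define r where "r = card S - 8"
    have cS: "card S = r + 8" using 3 by (simp add: r_def)
    note finS = less.prems(1)
    show ?thesis
    proof (rule ccontr)
      assume "\<not> ?thesis"
      then have few: "card (seen S c v) \<le> r + 2" if "v \<in> nsets S 3" for v using that cS by force
      let ?T = "nsets S 3"
      let ?C = "r + 8 choose 3"
      define F where "F i = {u \<in> ?T. c u = i}" for i
      have finT: "finite ?T" "card ?T = ?C" using finS cS by (auto simp: finite_imp_finite_nsets)
      \<comment> \<open>The triple from the induction hypothesis sees \<open>r + 2\<close> colours
        on triples avoiding \<open>x\<close>; \<open>few\<close> allows no further ones.\<close>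
      have blind: "\<exists>v\<in>?T. x \<notin> v \<and> seen S c v = seen (S - {x}) c v" if x: "x \<in> S" for x
      proof -
        have cx: "card (S - {x}) = r + 7" using cS finS x by simp
        have sub: "nsets (S - {x}) 3 \<subseteq> ?T" by (intro nsets_mono) auto
        have "\<exists>v\<in>nsets (S - {x}) 3. card (S - {x}) - 5 \<le> card (seen (S - {x}) c v)"
        proof (rule less.hyps)
          show "card (S - {x}) < card S" "finite (S - {x})" "6 \<le> card (S - {x})" using cx cS finS by auto
          show "c u \<noteq> c w" if "u \<in> nsets (S - {x}) 3" "w \<in> nsets (S - {x}) 3" "u \<inter> w = {}" for u w
            using that proper sub by blast
        qed
        then obtain v where v: "v \<in> nsets (S - {x}) 3" "r + 2 \<le> card (seen (S - {x}) c v)"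
          using cx by auto
        have "seen (S - {x}) c v \<subseteq> seen S c v" using sub by (auto simp: seen_def)
        then have "seen (S - {x}) c v = seen S c v"
          using v few[of v] sub finS by (intro card_seteq) auto
        then show ?thesis using v sub by (auto simp: nsets_def intro!: bexI[of _ v])
      qed
      have notseen: "i \<in> seen S c v \<longleftrightarrow> v \<notin> transversals S 3 (F i)" if "v \<in> ?T" for i v
        using that by (auto simp: seen_def F_def transversals_def)
      define I where "I = c ` ?T"
      have finI: "finite I" using finT by (simp add: I_def)
      \<comment> \<open>The excess of a colour class, an integer because it may be -1. Its sum over
        all classes will turn out both nonpositive and positive.\<close>
      define e where "e i = int ?C - int (card (transversals S 3 (F i))) - int ((r + 2) * card (F i))" for i
      have bound: "card (transversals S 3 (F i)) + (r + 2) * card (F i) + slack r \<le> ?C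
          \<or> card (F i) \<le> 3 * r + 15 \<and> card (transversals S 3 (F i)) \<le> (r + 7 choose 2) + 1"
        if i: "i \<in> I" for i
      proof (rule intersecting_class_bound[OF finS cS])
        show "F i \<subseteq> ?T" "F i \<noteq> {}" using i by (auto simp: F_def I_def)
        show "u \<inter> w \<noteq> {}" if "u \<in> F i" "w \<in> F i" for u w
          using proper[of u w] that by (auto simp: F_def)
        \<comment> \<open>A class all of whose members contain \<open>x\<close> has no colour to
          show on triples avoiding \<open>x\<close>, so the triple from \<open>blind\<close> does
          not see it and hence covers it.\<close>
        show "\<exists>v\<in>transversals S 3 (F i). x \<notin> v" if x: "x \<in> S" and st: "\<And>u. u \<in> F i \<Longrightarrow> x \<in> u" for x
        proof -
          obtain v where v: "v \<in> ?T" "x \<notin> v" "seen S c v = seen (S - {x}) c v" using blind[OF x] by blast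
          have "i \<notin> seen (S - {x}) c v"
          proof
            assume "i \<in> seen (S - {x}) c v"
            then obtain u where u: "u \<in> nsets (S - {x}) 3" "c u = i" by (auto simp: seen_def)
            then have "u \<in> F i" "x \<notin> u" by (auto simp: F_def nsets_def)
            then show False using st by blast
          qed
          then show ?thesis using v notseen[OF v(1)] by auto
        qed
      qed
      have sumF: "(\<Sum>i\<in>I. int (card (F i))) = int ?C"
      proof -
        have "card ?T = (\<Sum>i\<in>I. card (F i))"
          using sum.image_gen[OF finT(1), of "\<lambda>_. 1 :: nat" c] by (simp add: I_def F_def)
        then show ?thesis using finT by (simp flip: of_nat_sum)
      qed
      \<comment> \<open>Double counting of pairs of a triple and a colour seen from it.\<close>
      have "(\<Sum>i\<in>I. ?C - card (transversals S 3 (F i))) = (\<Sum>v\<in>?T. card (seen S c v))"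
      proof -
        have "(\<Sum>v\<in>?T. card {i \<in> I. i \<in> seen S c v}) = (\<Sum>i\<in>I. ?C - card (transversals S 3 (F i)))"
        proof (rule sum_multicount_gen[OF finT(1) finI], intro ballI)
          fix i assume "i \<in> I"
          have "{v \<in> ?T. i \<in> seen S c v} = ?T - transversals S 3 (F i)" using notseen by auto
          then show "card {v \<in> ?T. i \<in> seen S c v} = ?C - card (transversals S 3 (F i))"
            using finT finS transversals_subset[of S 3 "F i"] by (simp add: card_Diff_subset)
        qed
        moreover have "{i \<in> I. i \<in> seen S c v} = seen S c v" for v by (auto simp: I_def seen_def)
        ultimately show ?thesis by simp
      qed
      also have "\<dots> \<le> (\<Sum>v\<in>?T. r + 2)" using few by (intro sum_mono) auto
      finally have upper: "int (\<Sum>i\<in>I. ?C - card (transversals S 3 (F i))) \<le> int (?C * (r + 2))"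
        using finT unfolding of_nat_le_iff by simp
      have "int (\<Sum>i\<in>I. ?C - card (transversals S 3 (F i)))
          = (\<Sum>i\<in>I. e i + int (r + 2) * int (card (F i)))"
        unfolding of_nat_sum
      proof (rule sum.cong)
        fix i
        have "card (transversals S 3 (F i)) \<le> ?C"
          using card_mono[OF finT(1) transversals_subset] finT by simp
        then show "int (?C - card (transversals S 3 (F i))) = e i + int (r + 2) * int (card (F i))"
          by (simp add: e_def of_nat_diff algebra_simps)
      qed simp
      also have "\<dots> = (\<Sum>i\<in>I. e i) + int (r + 2) * int ?C"
        by (simp only: sum.distrib sumF flip: sum_distrib_left)
      finally have le0: "(\<Sum>i\<in>I. e i) \<le> 0"
        using upper unfolding of_nat_mult by (simp add: mult.commute[of "int ?C"])
      have "I \<noteq> {}" using cS by (simp add: I_def nsets_eq_empty_iff)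
      have "(\<Sum>i\<in>I. e i) > 0"
      proof (cases "r = 2 \<or> r = 3")
        case True
        have num: "10 choose 3 = (120::nat)" "11 choose 3 = (165::nat)" "9 choose 2 = (36::nat)" "10 choose 2 = (45::nat)"
          using six_choose_three[of 10] six_choose_three[of 11] two_choose_two[of 9] two_choose_two[of 10]
          by simp_all
        from True show ?thesis
        proof
          assume r: "r = 2"
          show ?thesis
          \<comment> \<open>\<open>b = 3 * r + 15\<close>, \<open>k = r + 2\<close>, and
            \<open>g = 120 - (36 + 1)\<close> is the number of triples minus the transversal bound
            for a maximal covered star. At most 120 div 21 = 5 disjoint classes have 21 members, and
            \<open>slack 2 = 6\<close> is \<open>m + 1\<close>.\<close>
          proof (rule sum_excess_pos[where m = 5 and b = 21 and g = 83 and k = 4 and C = 120, OF finI])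
            show "(\<Sum>i\<in>I. int (card (F i))) = 120" using sumF r num by simp
            show "5 + 1 \<le> e i \<or> int (card (F i)) \<le> 21 \<and> 83 - 4 * int (card (F i)) \<le> e i" if "i \<in> I" for i
              using bound[OF that] r num by (auto simp: e_def slack_def)
          qed auto
        next
          assume r: "r = 3"
          show ?thesis
          \<comment> \<open>By the same formulas, \<open>g = 165 - (45 + 1)\<close>, 165 div 24 = 6
            and \<open>slack 3 = 7\<close>.\<close>
          proof (rule sum_excess_pos[where m = 6 and b = 24 and g = 119 and k = 5 and C = 165, OF finI])
            show "(\<Sum>i\<in>I. int (card (F i))) = 165" using sumF r num by simp
            show "6 + 1 \<le> e i \<or> int (card (F i)) \<le> 24 \<and> 119 - 5 * int (card (F i)) \<le> e i" if "i \<in> I" for i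
              using bound[OF that] r num by (auto simp: e_def slack_def)
          qed auto
        qed
      next
        case False
        have "e i > 0" if "i \<in> I" for i
          using bound[OF that]
        proof
          assume "card (transversals S 3 (F i)) + (r + 2) * card (F i) + slack r \<le> ?C"
          moreover have "slack r > 0" by (simp add: slack_def)
          ultimately show ?thesis unfolding e_def by linarith
        next
          assume a: "card (F i) \<le> 3 * r + 15 \<and> card (transversals S 3 (F i)) \<le> (r + 7 choose 2) + 1"
          then have "(r + 2) * card (F i) \<le> (r + 2) * (3 * r + 15)" by (intro mult_left_mono) auto
          then show ?thesis using a full_star_arith[OF False] unfolding e_def by linarith
        qed
        then show ?thesis using finI \<open>I \<noteq> {}\<close> by (intro sum_pos) auto
      qed
      with le0 show False by simp
    qed
  qed
qed

section \<open>The local chromatic number\<close>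

lemma kneser_vertices_eq_nsets: "kneser_vertices n k = nsets {1..n} k"
  by (auto simp: kneser_vertices_def nsets_def intro: finite_subset)

text \<open>The closed neighbourhood adds the triple's own colour, which a proper colouring keeps
  apart from the seen ones; this turns \<open>n - 5\<close> into \<open>n - 4\<close>.\<close>

lemma kneser3_locality_ge:
  assumes "n \<ge> 6" "proper_coloring (kneser_vertices n 3) kneser_adj c"
  shows "n - 4 \<le> locality (kneser_vertices n 3) kneser_adj c"
proof -
  let ?V = "kneser_vertices n 3"
  have V: "?V = nsets {1..n} 3" by (rule kneser_vertices_eq_nsets)
  have proper: "c u \<noteq> c w" if "u \<in> ?V" "w \<in> ?V" "u \<inter> w = {}" for u w
    using that assms(2) by (auto simp: proper_coloring_def kneser_adj_def)
  obtain v where v: "v \<in> ?V" "n - 5 \<le> card (seen {1..n} c v)"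
    using exists_vertex_seeing_many[of "{1..n}" c] proper assms(1) V by auto
  have "c v \<notin> seen {1..n} c v" using v proper V by (auto simp: seen_def)
  moreover have "c ` closed_nbhd ?V kneser_adj v = insert (c v) (seen {1..n} c v)"
    by (auto simp: closed_nbhd_def kneser_adj_def seen_def V Int_commute)
  ultimately have "n - 4 \<le> card (c ` closed_nbhd ?V kneser_adj v)"
    using v(2) assms(1) by simp
  also have "\<dots> \<le> locality ?V kneser_adj c"
    unfolding locality_def using v(1) V by (intro Max_ge) (auto simp: finite_imp_finite_nsets)
  finally show ?thesis .
qed

text \<open>The standard colouring by least element, where all triples inside the last five points
  share the colour \<open>n - 4\<close>: two disjoint ones would need six points. Only
  \<open>n - 4\<close> colours are available in total, which bounds the locality.\<close>

lemma kneser3_coloring: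
  assumes "n \<ge> 6"
  defines "c \<equiv> \<lambda>A. min (Min A) (n - 4)"
  shows "proper_coloring (kneser_vertices n 3) kneser_adj c"
    and "locality (kneser_vertices n 3) kneser_adj c \<le> n - 4"
proof -
  let ?V = "kneser_vertices n 3"
  have V: "?V = nsets {1..n} 3" by (rule kneser_vertices_eq_nsets)
  have A: "finite A" "A \<noteq> {}" "A \<subseteq> {1..n}" "card A = 3" if "A \<in> ?V" for A
    using that by (auto simp: V nsets_def)
  show "proper_coloring ?V kneser_adj c"
    unfolding proper_coloring_def kneser_adj_def
  proof (intro ballI impI notI)
    fix A B assume AB: "A \<in> ?V" "B \<in> ?V" "A \<inter> B = {}" and eq: "c A = c B"
    note a = A[OF AB(1)] and b = A[OF AB(2)]
    have mem: "Min A \<in> A" "Min B \<in> B" using a b by auto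
    show False
    proof (cases "Min A < n - 4 \<or> Min B < n - 4")
      case True
      then have "Min A = Min B" using eq by (auto simp: c_def)
      then show False using mem AB(3) by auto
    next
      case False
      then have "A \<union> B \<subseteq> {n - 4..n}" using a b Min_le by fastforce
      then have "card (A \<union> B) \<le> card {n - 4..n}" by (intro card_mono) auto
      then show False using AB(3) a b assms(1) by (simp add: card_Un_disjoint)
    qed
  qed
  have range: "c A \<in> {1..n - 4}" if "A \<in> ?V" for A
  proof -
    have "Min A \<in> {1..n}" using A[OF that] Min_in by blast
    then show ?thesis using assms(1) by (auto simp: c_def)
  qed
  have "card (c ` closed_nbhd ?V kneser_adj v) \<le> n - 4" if "v \<in> ?V" for v
  proof -
    have "c ` closed_nbhd ?V kneser_adj v \<subseteq> {1..n - 4}"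
      using range that by (auto simp: closed_nbhd_def simp del: atLeastAtMost_iff)
    from card_mono[OF _ this] show ?thesis by simp
  qed
  moreover have "finite ?V" by (simp add: V finite_imp_finite_nsets)
  moreover have "?V \<noteq> {}" using assms(1) by (auto simp: V nsets_eq_empty_iff)
  ultimately show "locality ?V kneser_adj c \<le> n - 4"
    unfolding locality_def by (subst Max_le_iff) auto
qed

theorem mainTheorem4:
  fixes n :: nat
  assumes "n \<ge> 6"
  shows "local_chromatic_number (kneser_vertices n 3) kneser_adj = n - 4"
  unfolding local_chromatic_number_def
proof (rule Least_equality)
  show "\<exists>c. proper_coloring (kneser_vertices n 3) kneser_adj c
      \<and> locality (kneser_vertices n 3) kneser_adj c = n - 4"
    using kneser3_coloring[OF assms] kneser3_locality_ge[OF assms] le_antisym by blast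
  show "n - 4 \<le> k" if "\<exists>c. proper_coloring (kneser_vertices n 3) kneser_adj c
      \<and> locality (kneser_vertices n 3) kneser_adj c = k" for k
    using that kneser3_locality_ge[OF assms] by blast
qed

end
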